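(* For every natural number $k$, there is no algorithm (in the exploration model described in the context) that successfully explores all finite connected graphs of circumference at most $k$ and whose assigned nonzero colors, over all such graphs and all adversaries, all belong to a fixed set of at most $2k-4$ colors; that is, at least $2k-3$ colors are needed.
   Context: The circumference of a graph is the length of a longest simple cycle (taken to be $0$ for acyclic graphs). Exploration model. Graphs are finite, simple, undirected and connected; vertices are anonymous and edges carry no port labels. Each vertex carries a color in $\mathbb{N}=\{0,1,2,\dots\}$, where $0$ means "uncolored"; initially all vertices have color $0$. An algorithm is a function $\mathrm{move}$ mapping every environment $(c_0,E)$ — where $c_0\in\mathbb{N}$ is the color of the agent's current vertex and $E:\mathbb{N}\to\mathbb{N}$ (zero almost everywhere) gives, for each color $c$, the number $E(c)$ of neighbors of the current vertex having color $c$ — either to $\mathrm{Stop}$ or to a pair $(c_1,d)\in\mathbb{N}\times\mathbb{N}$ with $E(d)>0$, subject to $c_1=c_0$ whenever $c_0\neq 0$ (a vertex may only be colored while it is uncolored). A run on a graph $G$: an adversary chooses a start vertex $v_0$ and places the agent there; in each step, with the agent at $v$, $\mathrm{move}$ is evaluated at the environment of $v$; if the value is $\mathrm{Stop}$ the run ends, and if it is $(c_1,d)$ then $v$ receives color $c_1$ and the adversary chooses an arbitrary neighbor of $v$ of color $d$, to which the agent moves. The agent has no other memory. A vertex is visited if the agent is located at it in some step. An algorithm successfully explores $G$ if for every adversary (every choice of start vertex and of neighbors), after finitely many steps all vertices have been visited, the agent is at $v_0$, and the decision is $\mathrm{Stop}$. *)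

theory Defs
  imports "Graph_Theory.Graph_Theory"
begin

text \<open>
  A finite simple undirected graph is a loop-free symmetric digraph on pairs
  (\<^locale>\<open>pair_graph\<close>), so an edge \<open>uv\<close> is the pair of arcs \<open>(u, v)\<close> and \<open>(v, u)\<close>.
  With this encoding \<^const>\<open>pre_digraph.cycle\<close> also holds of the closed walk \<open>u, v, u\<close> along a
  single edge; the bound \<open>3 \<le> length p\<close> excludes it.
\<close>

definition circumference :: "'a pair_pre_digraph \<Rightarrow> nat" where
  "circumference G =
     Max (insert 0 {length p |p. pre_digraph.cycle (with_proj G) p \<and> 3 \<le> length p})"

definition connected_graph :: "'a pair_pre_digraph \<Rightarrow> bool" where
  "connected_graph G \<longleftrightarrow> pair_graph G \<and> connected (with_proj G)"


datatype decision = Stop | Go (new_colour: nat) (target_colour: nat)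

text \<open>
  An algorithm takes the environment \<open>(c\<^sub>0, E)\<close> as two arguments. It does not depend on the vertex
  type; every finite graph has a copy on vertices of type \<^typ>\<open>nat\<close>, so quantifying over
  \<^typ>\<open>nat pair_pre_digraph\<close> covers all finite graphs.
\<close>

type_synonym algorithm = "nat \<Rightarrow> (nat \<Rightarrow> nat) \<Rightarrow> decision"

text \<open>
  Only finitely supported counts are environments; the values of \<open>move\<close> elsewhere are irrelevant.
\<close>

definition valid_algorithm :: "algorithm \<Rightarrow> bool" where
  "valid_algorithm move \<longleftrightarrow>
     (\<forall>c0 E c1 d. finite {c. E c \<noteq> 0} \<and> move c0 E = Go c1 d \<longrightarrow>
        E d > 0 \<and> (c0 \<noteq> 0 \<longrightarrow> c1 = c0))"

type_synonym 'a config = "'a \<times> ('a \<Rightarrow> nat)"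

definition nbr_count :: "'a pair_pre_digraph \<Rightarrow> 'a config \<Rightarrow> nat \<Rightarrow> nat" where
  "nbr_count G s c = card {w. (fst s, w) \<in> parcs G \<and> snd s w = c}"

definition decide :: "algorithm \<Rightarrow> 'a pair_pre_digraph \<Rightarrow> 'a config \<Rightarrow> decision" where
  "decide move G s = move (snd s (fst s)) (nbr_count G s)"

definition adversary_step ::
    "algorithm \<Rightarrow> 'a pair_pre_digraph \<Rightarrow> 'a config \<Rightarrow> 'a config \<Rightarrow> bool" where
  "adversary_step move G s s' \<longleftrightarrow>
     (case decide move G s of
        Stop \<Rightarrow> s' = s
      | Go c1 d \<Rightarrow>
          (fst s, fst s') \<in> parcs G \<and> snd s (fst s') = d \<and> snd s' = (snd s)(fst s := c1))"

text \<open>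
  A run that ends is represented by the infinite sequence that repeats its last configuration.
  Quantifying over all runs is quantifying over all choices of the adversary.
\<close>

definition is_run :: "algorithm \<Rightarrow> 'a pair_pre_digraph \<Rightarrow> (nat \<Rightarrow> 'a config) \<Rightarrow> bool" where
  "is_run move G r \<longleftrightarrow>
     fst (r 0) \<in> pverts G \<and> snd (r 0) = (\<lambda>_. 0) \<and>
     (\<forall>i. adversary_step move G (r i) (r (Suc i)))"

definition explores :: "algorithm \<Rightarrow> 'a pair_pre_digraph \<Rightarrow> bool" where
  "explores move G \<longleftrightarrow>
     (\<forall>r. is_run move G r \<longrightarrow>
        (\<exists>n. decide move G (r n) = Stop \<and> fst (r n) = fst (r 0) \<and>
             pverts G \<subseteq> (\<lambda>i. fst (r i)) ` {..n}))"

definition assigned_colours :: "algorithm \<Rightarrow> 'a pair_pre_digraph \<Rightarrow> nat set" where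
  "assigned_colours move G =
     {c. c \<noteq> 0 \<and> (\<exists>r i d. is_run move G r \<and> decide move G (r i) = Go c d)}"

end

(*
  Fresh vertices reached along a chain of cliques receive colours that depend only on the colour of
  the first vertex of their clique, because the agent sees nothing but coloured neighbours in that
  clique and a fixed number of uncoloured ones. So every colour a has a set of successors: the
  colours of the k - 2 vertices that follow a vertex of colour a in its clique. These are distinct,
  since two vertices of the same colour in a clique could not be told apart. Now attach one more
  vertex v to the first vertex of a clique, of colour a, and to its last one, of colour c. If the
  agent leaves v towards colour a, the first vertex being a cut vertex, it cannot come back to
  complete the exploration of the last one. So it leaves v towards c. But v sees the same when c
  comes first and a last. Hence the successor relation is asymmetric, and a tournament in which all
  out-degrees are at least k - 2 has at least 2 (k - 2) + 1 vertices.
*)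

theory Submission
  imports Defs
begin

section \<open>Winning configurations\<close>

text \<open>The obstacle is uniformity: a colour has to be a function of the first colour of its
  clique, whatever graph lies around it. Leaves secure this by padding every chain vertex to degree
  2k - 2. Such a vertex has at most k - 2 earlier neighbours, k - 2 later ones and one extra vertex,
  so at least one leaf remains, and an unvisited leaf also forbids the agent to stop. The leaves
  complicate the comparison of two equally coloured vertices: colouring leaves changes what these
  see, so the adversary lets one of them run ahead and the other catch up. That a fresh vertex is
  coloured at all needs a separate adversary, which adds an indistinguishable twin. Chains replace
  single cliques because every colour of the tournament must be able to start a further clique at a
  cut vertex other than the start vertex.\<close>

text \<open>
  The exploring agent succeeds from a configuration, with set of visited vertices \<open>V\<close>, whatever the
  adversary does. Well-founded induction over this predicate replaces the explicit construction of
  runs: an invariant that some adversary move always preserves, and that excludes success, is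
  incompatible with it.
\<close>

inductive wins ::
  "algorithm \<Rightarrow> nat set \<Rightarrow> 'a pair_pre_digraph \<Rightarrow> 'a \<Rightarrow> 'a set \<Rightarrow> 'a config \<Rightarrow> bool"
  for move C G v0
where
  stop: "decide move G s = Stop \<Longrightarrow> fst s = v0 \<Longrightarrow> pverts G \<subseteq> V \<Longrightarrow> wins move C G v0 V s"
| go: "decide move G s = Go c d \<Longrightarrow> c \<in> insert 0 C \<Longrightarrow>
    (\<And>s'. adversary_step move G s s' \<Longrightarrow> wins move C G v0 (insert (fst s') V) s') \<Longrightarrow>
    wins move C G v0 V s"

lemma finite_neighbours:
  assumes "pair_graph G"
  shows "finite {w. (x, w) \<in> parcs G}"
proof -
  interpret pair_graph G by fact
  have "{w. (x, w) \<in> parcs G} \<subseteq> pverts G" by (auto dest: in_arcsD2)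
  then show ?thesis by (rule finite_subset) simp
qed

lemma finite_support_nbr_count:
  assumes "pair_graph G"
  shows "finite {c. nbr_count G s c \<noteq> 0}"
proof (rule finite_subset)
  show "{c. nbr_count G s c \<noteq> 0} \<subseteq> snd s ` {w. (fst s, w) \<in> parcs G}"
    by (auto simp: nbr_count_def card_eq_0_iff)
qed (intro finite_imageI finite_neighbours assms)

lemma Go_neighbour:
  assumes "valid_algorithm move" "pair_graph G" "decide move G s = Go c d"
  obtains y where "(fst s, y) \<in> parcs G" "snd s y = d"
proof -
  have "nbr_count G s d > 0"
    using assms finite_support_nbr_count[of G s] unfolding valid_algorithm_def decide_def by blast
  then have "{w. (fst s, w) \<in> parcs G \<and> snd s w = d} \<noteq> {}"
    unfolding nbr_count_def by (metis card.empty less_irrefl)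
  then show ?thesis using that by blast
qed

lemma Go_colour:
  assumes "valid_algorithm move" "pair_graph G" "decide move G s = Go c d" "snd s (fst s) \<noteq> 0"
  shows "c = snd s (fst s)"
  using assms finite_support_nbr_count[of G s] unfolding valid_algorithm_def decide_def by blast

lemma adversary_step_ex:
  assumes "valid_algorithm move" "pair_graph G"
  shows "\<exists>s'. adversary_step move G s s'"
proof (cases "decide move G s")
  case Stop
  then show ?thesis by (auto simp: adversary_step_def)
next
  case (Go c d)
  obtain y where "(fst s, y) \<in> parcs G" "snd s y = d"
    using Go_neighbour[OF assms Go] by blast
  then have "adversary_step move G s (y, (snd s)(fst s := c))"
    using Go by (simp add: adversary_step_def)
  then show ?thesis ..
qed

text \<open>A losing configuration has a losing answer, since otherwise \<open>go\<close> would make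
  it winning. An adversary that always picks such answers produces a run without a winning
  configuration, but success at some time would be one.\<close>

lemma explores_wins:
  assumes valid: "valid_algorithm move" and G: "pair_graph G"
    and ex: "explores move G" and col: "assigned_colours move G \<subseteq> C" and v0: "v0 \<in> pverts G"
  shows "wins move C G v0 {v0} (v0, \<lambda>_. 0)"
proof (rule ccontr)
  assume not: "\<not> wins move C G v0 {v0} (v0, \<lambda>_. 0)"
  let ?W = "wins move C G v0"
  define bad where "bad s \<longleftrightarrow> (\<exists>c d. decide move G s = Go c d \<and> c \<notin> insert 0 C)" for s
  define nxt where "nxt V s = (SOME s'. adversary_step move G s s' \<and>
      ((\<exists>s''. adversary_step move G s s'' \<and> \<not> ?W (insert (fst s'') V) s'')
         \<longrightarrow> \<not> ?W (insert (fst s') V) s'))" for V s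
  have nxt: "adversary_step move G s (nxt V s) \<and>
      ((\<exists>s''. adversary_step move G s s'' \<and> \<not> ?W (insert (fst s'') V) s'')
         \<longrightarrow> \<not> ?W (insert (fst (nxt V s)) V) (nxt V s))" for V s
    unfolding nxt_def by (rule someI_ex) (use adversary_step_ex[OF valid G] in blast)
  \<comment> \<open>\<open>wins\<close> depends on the visited set, so the recursion carries that
    set along with the configuration.\<close>
  define st where "st = rec_nat ({v0}, (v0, \<lambda>_. 0))
     (\<lambda>_ (V, s). (insert (fst (nxt V s)) V, nxt V s))"
  have st_0: "st 0 = ({v0}, (v0, \<lambda>_. 0))" by (simp add: st_def)
  have st_Suc: "st (Suc n) = (insert (fst (nxt (fst (st n)) (snd (st n)))) (fst (st n)),
      nxt (fst (st n)) (snd (st n)))" for n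
    by (simp add: st_def case_prod_beta)
  define r where "r n = snd (st n)" for n
  have run: "is_run move G r"
    unfolding is_run_def r_def by (simp add: st_0 st_Suc v0 nxt)
  have fst_st: "fst (st n) = (\<lambda>i. fst (r i)) ` {..n}" for n
    by (induction n) (auto simp: r_def st_0 st_Suc atMost_Suc)
  have not_bad: "\<not> bad (r i)" for i
  proof
    assume "bad (r i)"
    then obtain c d where "decide move G (r i) = Go c d" "c \<notin> insert 0 C" by (auto simp: bad_def)
    then have "c \<in> assigned_colours move G" using run by (auto simp: assigned_colours_def)
    then show False using col \<open>c \<notin> insert 0 C\<close> by auto
  qed
  have lose: "\<not> ?W (fst (st n)) (r n)" for n
  proof (induction n)
    case 0
    then show ?case using not by (simp add: r_def st_0)
  next
    case (Suc n)
    have "\<exists>s''. adversary_step move G (r n) s'' \<and> \<not> ?W (insert (fst s'') (fst (st n))) s''"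
    proof (cases "decide move G (r n)")
      case Stop
      have "insert (fst (r n)) (fst (st n)) = fst (st n)" by (auto simp: fst_st)
      then show ?thesis
        using Suc Stop by (intro exI[of _ "r n"]) (simp add: adversary_step_def)
    next
      case (Go c d)
      then have "c \<in> insert 0 C" using not_bad[of n] by (auto simp: bad_def)
      then show ?thesis using Suc Go wins.go by metis
    qed
    then show ?case
      using nxt[of "snd (st n)" "fst (st n)"] by (simp add: r_def st_Suc)
  qed
  obtain n where "decide move G (r n) = Stop" "fst (r n) = fst (r 0)"
    "pverts G \<subseteq> (\<lambda>i. fst (r i)) ` {..n}"
    using ex run unfolding explores_def by blast
  then have "?W (fst (st n)) (r n)"
    by (intro wins.stop) (simp_all add: fst_st, simp add: r_def st_0)
  then show False using lose by blast
qed

text \<open>The adversary keeps to \<open>Inv\<close> until \<open>Q\<close> holds. It cannot do so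
  forever because \<open>wins\<close> is well-founded, and every answer in a winning configuration
  is again winning, so \<open>Q\<close> is reached in a winning one.\<close>

lemma wins_until:
  assumes valid: "valid_algorithm move" and G: "pair_graph G"
    and win: "wins move C G v0 V (x, col)" and inv: "Inv V x col"
    and stop: "\<And>V x col. Inv V x col \<Longrightarrow> decide move G (x, col) = Stop \<Longrightarrow> x = v0 \<Longrightarrow>
      pverts G \<subseteq> V \<Longrightarrow> False"
    and step: "\<And>V x col c d. Inv V x col \<Longrightarrow> decide move G (x, col) = Go c d \<Longrightarrow>
      (col x \<noteq> 0 \<Longrightarrow> c = col x) \<Longrightarrow> (\<exists>y. (x, y) \<in> parcs G \<and> col y = d) \<Longrightarrow>
      \<exists>y. (x, y) \<in> parcs G \<and> col y = d \<and>
        (Inv (insert y V) y (col(x := c)) \<or> Q (insert y V) y (col(x := c)))"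
  shows "\<exists>V' x' col'. wins move C G v0 V' (x', col') \<and> Q V' x' col'"
proof -
  have "Inv V (fst s) (snd s) \<Longrightarrow> ?thesis" if "wins move C G v0 V s" for V s
    using that
  proof (induction V s rule: wins.induct)
    case (stop s V)
    then show ?case using assms(5)[of V "fst s" "snd s"] by auto
  next
    case (go s c d V)
    obtain x col where s: "s = (x, col)" by (cases s)
    have "\<exists>y. (x, y) \<in> parcs G \<and> col y = d"
      using Go_neighbour[OF valid G go.hyps(1)] s by auto
    moreover have "col x \<noteq> 0 \<Longrightarrow> c = col x"
      using Go_colour[OF valid G go.hyps(1)] s by auto
    ultimately obtain y where y: "(x, y) \<in> parcs G" "col y = d"
      "Inv (insert y V) y (col(x := c)) \<or> Q (insert y V) y (col(x := c))"
      using step[of V x col c d] go.prems go.hyps(1) s by auto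
    have st: "adversary_step move G s (y, col(x := c))"
      using go.hyps(1) y s by (simp add: adversary_step_def)
    from y(3) show ?case
    proof
      assume "Inv (insert y V) y (col(x := c))"
      then show ?thesis using go.IH[OF st] unfolding fst_conv snd_conv by blast
    next
      assume "Q (insert y V) y (col(x := c))"
      then show ?thesis using go.hyps(3)[OF st] unfolding fst_conv by blast
    qed
  qed
  from this[OF win] show ?thesis using inv by simp
qed

lemma wins_trap:
  assumes "valid_algorithm move" "pair_graph G"
    and "wins move C G v0 V (x, col)" "Inv V x col"
    and "\<And>V x col. Inv V x col \<Longrightarrow> decide move G (x, col) = Stop \<Longrightarrow> x = v0 \<Longrightarrow>
      pverts G \<subseteq> V \<Longrightarrow> False"
    and "\<And>V x col c d. Inv V x col \<Longrightarrow> decide move G (x, col) = Go c d \<Longrightarrow>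
      (col x \<noteq> 0 \<Longrightarrow> c = col x) \<Longrightarrow> (\<exists>y. (x, y) \<in> parcs G \<and> col y = d) \<Longrightarrow>
      \<exists>y. (x, y) \<in> parcs G \<and> col y = d \<and> Inv (insert y V) y (col(x := c))"
  shows False
proof -
  have "\<exists>V' x' col'. wins move C G v0 V' (x', col') \<and> False"
    by (rule wins_until[where Inv = Inv and Q = "\<lambda>_ _ _. False", OF assms(1-4)])
      (use assms(5,6) in simp_all)
  then show False by simp
qed

section \<open>Cycles and cut vertices\<close>

lemma heads_confined:
  assumes "pcas u p v" "set p \<subseteq> A" "u \<in> S" "\<And>x z. x \<in> S \<Longrightarrow> (x, z) \<in> A \<Longrightarrow> z \<in> insert b S"
    and "b \<notin> snd ` set p"
  shows "snd ` set p \<subseteq> S"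
  using assms(1,2,3,5)
proof (induction p arbitrary: u)
  case Nil
  then show ?case by simp
next
  case (Cons e p)
  have "snd e \<in> S" using Cons.prems assms(4)[of "fst e" "snd e"] by (cases e) auto
  then show ?case using Cons by auto
qed

lemma pcas_append: "pcas u (p @ q) v \<longleftrightarrow> (\<exists>w. pcas u p w \<and> pcas w q v)"
  by (induction p arbitrary: u) auto

text \<open>Without \<open>b\<close>, the cycle is a walk that cannot change between
  \<open>S\<close> and the complement of \<open>insert b S\<close>. Heads are distinct, so
  \<open>b\<close> is met at most once and a single cut suffices.\<close>

lemma cycle_side:
  assumes G: "pair_graph G" and cyc: "pcas u p u" "set p \<subseteq> parcs G" "distinct (map snd p)"
    and y: "y \<in> snd ` set p" "y \<in> S" and b: "b \<notin> S"
    and S: "\<And>x z. x \<in> S \<Longrightarrow> (x, z) \<in> parcs G \<Longrightarrow> z \<in> insert b S"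
  shows "snd ` set p \<subseteq> insert b S"
proof -
  interpret pair_graph G by fact
  define T where "T = - insert b S"
  have T: "z \<in> insert b T" if "x \<in> T" "(x, z) \<in> parcs G" for x z
    using S[of z x] that arcs_symmetric[of x z] by (auto simp: T_def)
  have sides: "snd ` set q \<subseteq> S"
    if "pcas w q v" "set q \<subseteq> parcs G" "w \<noteq> b" "b \<notin> snd ` set q" "y = w \<or> y \<in> snd ` set q" for w q v
  proof (cases "w \<in> S")
    case True
    show ?thesis
      by (rule heads_confined[OF that(1,2) True _ that(4)]) (rule S)
  next
    case False
    then have "w \<in> T" using that by (simp add: T_def)
    then have "snd ` set q \<subseteq> T"
      by (rule heads_confined[OF that(1,2) _ _ that(4)]) (rule T)
    then show ?thesis using that(5) y(2) \<open>w \<in> T\<close> by (auto simp: T_def)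
  qed
  show ?thesis
  proof (cases "b \<in> snd ` set p")
    case False
    have "p \<noteq> []" using y by auto
    then have "u \<in> snd ` set p"
      using cyc(1) by (induction p rule: rev_induct) (auto simp: pcas_append)
    then have "u \<noteq> b" using False by auto
    from sides[OF cyc(1,2) this False] y(1) show ?thesis by blast
  next
    case True
    then obtain e where e: "e \<in> set p" "snd e = b" by auto
    then obtain p1 p2 where p: "p = p1 @ e # p2" by (meson split_list)
    have "y \<noteq> b" using y b by auto
    then have y': "y \<in> snd ` set (p2 @ p1)" using y(1) e p by auto
    have nb: "b \<notin> snd ` set (p2 @ p1)" using cyc(3) e p by auto
    obtain w where "pcas u p1 w" "pcas w (e # p2) u"
      using cyc(1) unfolding p pcas_append by blast
    then have "pcas u (p1 @ [e]) b" "pcas b p2 u"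
      using e(2) by (auto simp only: pcas_append pcas.simps)
    \<comment> \<open>The cycle is rotated so that \<open>e\<close>, its only arc into
      \<open>b\<close>, comes last.\<close>
    then have "pcas b (p2 @ p1 @ [e]) b" unfolding pcas_append[of b p2] by blast
    moreover obtain f q where q: "p2 @ p1 = f # q" using y' by (cases "p2 @ p1") auto
    ultimately have "pcas b (f # q @ [e]) b" by (metis append_Cons append_assoc)
    then have "pcas (snd f) (q @ [e]) b" by simp
    then obtain w where w: "pcas (snd f) q w" unfolding pcas_append by blast
    have "set (p2 @ p1) \<subseteq> parcs G" using cyc(2) p by auto
    then have "set q \<subseteq> parcs G" unfolding q by simp
    moreover have "snd f \<noteq> b" "b \<notin> snd ` set q" "y = snd f \<or> y \<in> snd ` set q"
      using nb y' unfolding q by auto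
    ultimately have "snd ` set q \<subseteq> S" using sides[OF w] by blast
    moreover have "snd f \<in> S"
    proof (rule ccontr)
      assume "snd f \<notin> S"
      then have "snd f \<in> T" using \<open>snd f \<noteq> b\<close> by (simp add: T_def)
      then have "snd ` set q \<subseteq> T"
        by (rule heads_confined[OF w \<open>set q \<subseteq> parcs G\<close> _ _ \<open>b \<notin> snd ` set q\<close>]) (rule T)
      then show False using \<open>y = snd f \<or> y \<in> snd ` set q\<close> y(2) \<open>snd f \<in> T\<close> by (auto simp: T_def)
    qed
    ultimately have "snd ` set (p2 @ p1) \<subseteq> S" unfolding q by auto
    then show ?thesis using e p by auto
  qed
qed

section \<open>Caterpillar graphs over chains of cliques\<close>

definition core_nbrs :: "nat \<Rightarrow> (nat \<Rightarrow> nat set) \<Rightarrow> nat \<Rightarrow> nat set" where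
  "core_nbrs M U j = {l. l \<le> M \<and> (l \<in> U j \<or> j \<in> U l)}"

text \<open>
  The core consists of the vertices \<open>0, \<dots>, M\<close>, where \<open>U j\<close> is the set of smaller neighbours of \<open>j\<close>.
  A vertex \<open>y > M\<close> is a leaf attached to \<open>y mod Suc M\<close>; there are as many leaves at \<open>j\<close> as it takes to
  give \<open>j\<close> the degree \<open>D j\<close>.
\<close>

definition leafy_graph :: "nat \<Rightarrow> (nat \<Rightarrow> nat set) \<Rightarrow> (nat \<Rightarrow> nat) \<Rightarrow> nat pair_pre_digraph" where
  "leafy_graph M U D =
     (let V = {y. y div Suc M \<le> D (y mod Suc M) - card (core_nbrs M U (y mod Suc M))};
          back = (\<lambda>y. if y \<le> M then U y else {y mod Suc M})
      in \<lparr>pverts = V, parcs = {(x, y). x \<in> V \<and> y \<in> V \<and> (x \<in> back y \<or> y \<in> back x)}\<rparr>)"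

text \<open>By \<open>U_chord\<close>, an earlier vertex that is not adjacent to \<open>j\<close> is
  not adjacent to any later core vertex either: what has been left behind stays behind.
  \<open>U_nonempty\<close> gives connectedness, and \<open>core_degree\<close> makes the truncated
  subtraction in the number of leaves exact.\<close>

locale leafy =
  fixes M :: nat and U :: "nat \<Rightarrow> nat set" and D :: "nat \<Rightarrow> nat"
  assumes U_less: "j \<le> M \<Longrightarrow> i \<in> U j \<Longrightarrow> i < j"
    and U_nonempty: "0 < j \<Longrightarrow> j \<le> M \<Longrightarrow> U j \<noteq> {}"
    and U_chord: "i < j \<Longrightarrow> j < l \<Longrightarrow> l \<le> M \<Longrightarrow> i \<in> U l \<Longrightarrow> i \<in> U j"
    and core_degree: "j \<le> M \<Longrightarrow> card (core_nbrs M U j) \<le> D j"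
begin

abbreviation G :: "nat pair_pre_digraph" where "G \<equiv> leafy_graph M U D"

definition leaves :: "nat \<Rightarrow> nat set" where
  "leaves j = {y \<in> pverts G. M < y \<and> y mod Suc M = j}"

abbreviation nbrs :: "nat \<Rightarrow> nat set" where "nbrs x \<equiv> {w. (x, w) \<in> parcs G}"

lemma pverts_G: "pverts G = {y. y div Suc M \<le> D (y mod Suc M) - card (core_nbrs M U (y mod Suc M))}"
  by (simp add: leafy_graph_def Let_def)

lemma core_in_G: "j \<le> M \<Longrightarrow> j \<in> pverts G"
  by (simp add: pverts_G)

lemma parcs_G: "(x, y) \<in> parcs G \<longleftrightarrow> x \<in> pverts G \<and> y \<in> pverts G \<and>
    (x \<in> (if y \<le> M then U y else {y mod Suc M}) \<or> y \<in> (if x \<le> M then U x else {x mod Suc M}))"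
  by (simp add: leafy_graph_def Let_def)

lemma mod_core: "y mod Suc M \<le> M"
  using mod_less_divisor[of "Suc M" y] by simp

section \<open>Neighbourhoods and degrees in the leafy graph\<close>

lemma nbrs_core:
  assumes j: "j \<le> M"
  shows "nbrs j = core_nbrs M U j \<union> leaves j"
proof (intro set_eqI)
  fix y
  show "y \<in> nbrs j \<longleftrightarrow> y \<in> core_nbrs M U j \<union> leaves j"
  proof (cases "y \<le> M")
    case True
    then show ?thesis using j by (simp add: parcs_G core_in_G core_nbrs_def leaves_def disj_commute)
  next
    case False
    then have "y \<notin> U j" using U_less[OF j, of y] j by auto
    then show ?thesis
      using False j by (auto simp add: parcs_G core_in_G core_nbrs_def leaves_def)
  qed
qed

lemma nbrs_leaf:
  assumes y: "y \<in> leaves j"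
  shows "nbrs y = {j}"
proof (intro set_eqI)
  fix x
  have j: "j = y mod Suc M" "j \<le> M" and yM: "\<not> y \<le> M" and yG: "y \<in> pverts G"
    using y mod_core[of y] by (auto simp: leaves_def)
  show "x \<in> nbrs y \<longleftrightarrow> x \<in> {j}"
  proof (cases "x \<le> M")
    case True
    then have "y \<notin> U x" using U_less[OF True, of y] yM by auto
    then show ?thesis using True j yM yG by (simp add: parcs_G core_in_G)
  next
    case False
    then have "y \<noteq> x mod Suc M" "x \<noteq> j" using mod_core[of x] yM j by auto
    then show ?thesis using False yM j(1)[symmetric] by (simp add: parcs_G)
  qed
qed

lemma leaves_gt: "y \<in> leaves j \<Longrightarrow> M < y"
  by (simp add: leaves_def)

lemma leaves_disjoint: "y \<in> leaves i \<Longrightarrow> y \<in> leaves j \<Longrightarrow> i = j"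
  by (simp add: leaves_def)

lemma leaves_le: "y \<in> leaves j \<Longrightarrow> j \<le> M"
  using mod_core by (auto simp: leaves_def)

lemma pverts_cases:
  assumes "y \<in> pverts G"
  obtains "y \<le> M" | j where "y \<in> leaves j" "j \<le> M"
  using assms mod_core[of y] by (cases "y \<le> M") (auto simp: leaves_def)

lemma leaves_eq:
  assumes "j \<le> M"
  shows "leaves j = (\<lambda>t. t * Suc M + j) ` {1..D j - card (core_nbrs M U j)}"
proof (intro set_eqI iffI)
  fix y assume y: "y \<in> leaves j"
  then have "y div Suc M * Suc M + j = y" by (metis (mono_tags, lifting) div_mult_mod_eq leaves_def mem_Collect_eq)
  moreover have "y div Suc M \<ge> 1"
    using y by (auto simp: leaves_def Suc_le_eq div_greater_zero_iff)
  moreover have "y div Suc M \<le> D j - card (core_nbrs M U j)"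
    using y by (auto simp: leaves_def pverts_G)
  ultimately show "y \<in> (\<lambda>t. t * Suc M + j) ` {1..D j - card (core_nbrs M U j)}"
    by (intro image_eqI[of _ _ "y div Suc M"]) auto
next
  fix y assume "y \<in> (\<lambda>t. t * Suc M + j) ` {1..D j - card (core_nbrs M U j)}"
  then obtain t where t: "y = t * Suc M + j" "1 \<le> t" "t \<le> D j - card (core_nbrs M U j)" by auto
  have m: "y mod Suc M = j" unfolding t(1) using assms by (simp only: mod_mult_self3) simp
  have d: "y div Suc M = t" unfolding t(1) using assms by (simp only: div_mult_self3) simp
  have "Suc M \<le> t * Suc M" using t(2) by (cases t) auto
  then have "M < y" using t(1) by linarith
  then show "y \<in> leaves j" using m d t(3) by (simp add: leaves_def pverts_G)
qed

lemma card_leaves: "j \<le> M \<Longrightarrow> card (leaves j) = D j - card (core_nbrs M U j)"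
  unfolding leaves_eq by (subst card_image) (auto simp: inj_on_def simp del: mult_Suc_right)

lemma finite_core_nbrs: "finite (core_nbrs M U j)"
  by (rule finite_subset[of _ "{..M}"]) (auto simp: core_nbrs_def)

lemma finite_leaves: "finite (leaves j)"
proof (cases "j \<le> M")
  case True
  then show ?thesis by (simp add: leaves_eq)
next
  case False
  then have "leaves j = {}" using leaves_le by auto
  then show ?thesis by simp
qed

lemma card_nbrs: "j \<le> M \<Longrightarrow> card (nbrs j) = D j"
proof -
  assume j: "j \<le> M"
  have "core_nbrs M U j \<inter> leaves j = {}" by (auto simp: core_nbrs_def leaves_def)
  then show ?thesis
    unfolding nbrs_core[OF j]
    using card_Un_disjoint[OF finite_core_nbrs finite_leaves] card_leaves[OF j] core_degree[OF j] by simp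
qed

section \<open>The leafy graph is simple and connected\<close>

lemma pair_graph_G: "pair_graph G"
proof -
  have "pverts G \<subseteq> {..M} \<union> (\<Union>j\<le>M. leaves j)"
    by (auto elim: pverts_cases)
  then have fin: "finite (pverts G)" by (rule finite_subset) (simp add: finite_leaves)
  have "parcs G \<subseteq> pverts G \<times> pverts G" by (auto simp: parcs_G)
  then have fina: "finite (parcs G)" using fin by (meson finite_SigmaI finite_subset)
  have sym: "(x, y) \<in> parcs G \<Longrightarrow> (y, x) \<in> parcs G" for x y by (auto simp: parcs_G)
  have loop: "x \<noteq> y" if "(x, y) \<in> parcs G" for x y
  proof (cases "x \<le> M")
    case True
    then show ?thesis using U_less[of x x] that by (auto simp: parcs_G)
  next
    case False
    then have "x mod Suc M \<noteq> x" using mod_core by metis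
    then show ?thesis using False that by (auto simp: parcs_G)
  qed
  have symm: "symmetric (with_proj G)"
    unfolding symmetric_def with_proj_simps by (rule symI) (rule sym)
  have mem: "fst e \<in> pverts G \<and> snd e \<in> pverts G" if "e \<in> parcs G" for e
    using that parcs_G[of "fst e" "snd e"] by simp
  have loop': "fst e \<noteq> snd e" if "e \<in> parcs G" for e
    using that loop[of "fst e" "snd e"] by simp
  show ?thesis
    by unfold_locales (simp_all add: fin fina mem loop' symm)
qed

lemma G_sym: "(x, y) \<in> parcs G \<Longrightarrow> (y, x) \<in> parcs G"
  by (auto simp: parcs_G)

lemma connected_G: "connected_graph G"
proof -
  interpret pair_graph G by (rule pair_graph_G)
  \<comment> \<open>A smaller neighbour exists everywhere except at 0, so descent leads to
    0.\<close>
  have up: "\<exists>z<y. (y, z) \<in> parcs G" if y: "y \<in> pverts G" "0 < y" for y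
  proof (cases "y \<le> M")
    case True
    then obtain i where "i \<in> U y" using U_nonempty[OF y(2) True] by auto
    then show ?thesis
      using U_less[of y i] True y core_in_G[of i] by (intro exI[of _ i]) (simp add: parcs_G)
  next
    case False
    have "y mod Suc M < y" using mod_core[of y] False by linarith
    then show ?thesis
      using False y core_in_G[OF mod_core] by (intro exI[of _ "y mod Suc M"]) (simp add: parcs_G)
  qed
  have to0: "y \<rightarrow>\<^sup>*\<^bsub>with_proj G\<^esub> 0" if "y \<in> pverts G" for y
    using that
  proof (induction y rule: less_induct)
    case (less y)
    show ?case
    proof (cases "y = 0")
      case True
      then show ?thesis using less.prems by simp
    next
      case False
      then obtain z where z: "z < y" "(y, z) \<in> parcs G" using up less.prems by auto
      then have "z \<in> pverts G" by (auto dest: in_arcsD2)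
      then have "z \<rightarrow>\<^sup>*\<^bsub>with_proj G\<^esub> 0" using less.IH z by blast
      then show ?thesis using z by (intro adj_reachable_trans[of y z 0]) simp_all
    qed
  qed
  have "u \<rightarrow>\<^sup>*\<^bsub>with_proj G\<^esub> v" if "u \<in> pverts G" "v \<in> pverts G" for u v
    using to0[OF that(1)] symmetric_reachable'[OF to0[OF that(2)]] reachable_trans by blast
  then have "u \<rightarrow>\<^sup>*\<^bsub>with_proj (mk_symmetric (with_proj G))\<^esub> v" if "u \<in> pverts G" "v \<in> pverts G" for u v
    using that reachable_mk_symmetricI by simp
  then have "connected (with_proj G)"
    unfolding connected_def using core_in_G[of 0] by (intro strongly_connectedI) auto
  then show ?thesis using pair_graph_G by (simp add: connected_graph_def)
qed

section \<open>Sides of cut vertices and the circumference bound\<close>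

definition side :: "nat \<Rightarrow> nat set" where
  "side b = {x. b < x \<and> x \<le> M} \<union> (\<Union>x\<in>{x. b < x \<and> x \<le> M}. leaves x)"

lemma sideE:
  assumes "x \<in> side b"
  obtains "b < x" "x \<le> M" | i where "b < i" "i \<le> M" "x \<in> leaves i"
  using assms by (auto simp: side_def)

lemma core_side: "x \<le> M \<Longrightarrow> x \<in> side b \<longleftrightarrow> b < x"
  using leaves_gt[of x] by (auto simp: side_def)

lemma leaves_side:
  assumes x: "x \<in> leaves i"
  shows "x \<in> side b \<longleftrightarrow> b < i"
proof
  assume "x \<in> side b"
  then show "b < i"
  proof (cases rule: sideE)
    case 1
    then show ?thesis using leaves_gt[OF x] by simp
  next
    case (2 j)
    then show ?thesis using leaves_disjoint[OF x 2(3)] by simp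
  qed
next
  assume "b < i"
  then show "x \<in> side b" using x leaves_le[OF x] by (auto simp: side_def)
qed

lemma side_closed:
  assumes cut: "\<And>i l. i < b \<Longrightarrow> b < l \<Longrightarrow> l \<le> M \<Longrightarrow> i \<notin> U l"
    and x: "x \<in> side b" and arc: "(x, y) \<in> parcs G"
  shows "y \<in> insert b (side b)"
  using x
proof (cases rule: sideE)
  case 1
  then consider "y \<in> leaves x" | "y \<le> M" "y \<in> U x" | "y \<le> M" "x \<in> U y"
    using nbrs_core[of x] arc by (auto simp: core_nbrs_def)
  then show ?thesis
  proof cases
    case 1
    then show ?thesis using leaves_side[of y x b] \<open>b < x\<close> by simp
  next
    case 2
    then have "\<not> y < b" using cut[of y x] \<open>b < x\<close> \<open>x \<le> M\<close> by blast
    then show ?thesis using core_side[of y b] 2(1) by auto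
  next
    case 3
    then show ?thesis using U_less[of y x] core_side[of y b] \<open>b < x\<close> by auto
  qed
next
  case (2 i)
  then have "y = i" using nbrs_leaf[of x i] arc by blast
  then show ?thesis using 2 core_side[of i b] by simp
qed

text \<open>The largest vertex \<open>j\<close> of a cycle lies in \<open>side b\<close> for the cut
  vertex \<open>b\<close> belonging to \<open>j\<close>, which confines the cycle to
  \<open>{b..j}\<close>, an interval of at most \<open>k\<close> vertices.\<close>

lemma circumference_le:
  assumes cut: "\<And>j. 0 < j \<Longrightarrow> j \<le> M \<Longrightarrow> \<exists>b<j. U j \<subseteq> {b..<j} \<and> Suc j \<le> b + k \<and>
      (\<forall>i l. i < b \<longrightarrow> b < l \<longrightarrow> l \<le> M \<longrightarrow> i \<notin> U l)"
  shows "circumference G \<le> k"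
proof -
  interpret pair_graph G by (rule pair_graph_G)
  have le: "length p \<le> k" if p: "pre_digraph.cycle (with_proj G) p" "3 \<le> length p" for p
  proof -
    obtain u where u: "pcas u p u" "set p \<subseteq> parcs G" "distinct (tl (pawalk_verts u p))" "p \<noteq> []"
      using p(1) unfolding cycle_def awalk_def by auto
    have "tl (pawalk_verts u q) = map snd q" if "pcas u q v" for u v q
      using that
    proof (induction q arbitrary: u)
      case (Cons e q)
      then show ?case by (cases q) auto
    qed simp
    then have dist: "distinct (map snd p)" using u by metis
    define H where "H = snd ` set p"
    have card_H: "card H = length p" using distinct_card[OF dist] by (simp add: H_def)
    have H_sub: "H \<subseteq> pverts G" unfolding H_def using u(2) arc_snd_in_verts by blast
    have fin: "finite H" by (simp add: H_def)
    note cycle = cycle_side[OF pair_graph_G u(1,2) dist, folded H_def]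
    have no_leaf: "y \<notin> leaves j" if "y \<in> H" for y j
    proof
      assume y: "y \<in> leaves j"
      have "j \<noteq> y" using leaves_gt[OF y] leaves_le[OF y] by simp
      \<comment> \<open>The singleton \<open>{y}\<close> is a side with cut vertex \<open>j\<close>,
        which leaves at most two vertices for the cycle.\<close>
      then have "H \<subseteq> {j, y}" using cycle[of y "{y}" j] that nbrs_leaf[OF y] by auto
      then have "card H \<le> card {j, y}" by (intro card_mono) auto
      also have "\<dots> \<le> 2" by (simp add: card_insert_if)
      finally show False using card_H p(2) by simp
    qed
    have H_core: "H \<subseteq> {..M}"
      using H_sub no_leaf by (auto elim!: pverts_cases)
    have "H \<noteq> {}" using p(2) card_H by auto
    define j where "j = Max H"
    have j: "j \<in> H" "\<And>x. x \<in> H \<Longrightarrow> x \<le> j" using fin \<open>H \<noteq> {}\<close> by (auto simp: j_def)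
    have "j \<le> M" using j(1) H_core by auto
    have "j \<noteq> 0"
    proof
      assume "j = 0"
      then have "H \<subseteq> {0}" using j(2) by auto
      then have "card H \<le> card {0::nat}" by (intro card_mono) auto
      then show False using card_H p(2) by simp
    qed
    then obtain b where b: "b < j" "U j \<subseteq> {b..<j}" "Suc j \<le> b + k"
      "\<And>i l. i < b \<Longrightarrow> b < l \<Longrightarrow> l \<le> M \<Longrightarrow> i \<notin> U l"
      using cut[of j] \<open>j \<le> M\<close> by blast
    have "b \<notin> side b" "j \<in> side b" using core_side \<open>j \<le> M\<close> b(1) by auto
    then have H_side: "H \<subseteq> insert b (side b)"
      by (intro cycle[OF j(1)]) (assumption | rule side_closed[OF b(4)])+
    have "b \<le> x" if x: "x \<in> H" for x
    proof (cases "x = b")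
      case False
      then have "x \<in> side b" using H_side x by blast
      moreover have "x \<le> M" using H_core x by auto
      ultimately show ?thesis using core_side by simp
    qed simp
    then have "H \<subseteq> {b..j}" using j(2) by auto
    then have "card H \<le> card {b..j}" by (intro card_mono) auto
    then show ?thesis using card_H b by simp
  qed
  then have sub: "insert 0 {length p |p. pre_digraph.cycle (with_proj G) p \<and> 3 \<le> length p} \<subseteq> {..k}"
    by blast
  show ?thesis
    unfolding circumference_def
    using sub by (intro Max.boundedI finite_subset[OF sub]) blast+
qed

end

section \<open>Walking along a chain of cliques\<close>

text \<open>The environment of a vertex of degree \<open>d\<close> whose neighbours outside
  \<open>T\<close> are all uncoloured.\<close>

definition env :: "(nat \<Rightarrow> nat) \<Rightarrow> nat set \<Rightarrow> nat \<Rightarrow> nat \<Rightarrow> nat" where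
  "env \<gamma> T d = (\<lambda>c. card {l \<in> T. \<gamma> l = c} + (if c = 0 then d - card T else 0))"

lemma nbr_count_env:
  assumes fin: "finite {w. (x, w) \<in> parcs G}" and T: "T \<subseteq> {w. (x, w) \<in> parcs G}"
    and "\<And>w. w \<in> T \<Longrightarrow> col w = \<gamma> w"
    and "\<And>w. (x, w) \<in> parcs G \<Longrightarrow> w \<notin> T \<Longrightarrow> col w = 0"
  shows "nbr_count G (x, col) = env \<gamma> T (card {w. (x, w) \<in> parcs G})"
proof
  fix c
  let ?N = "{w. (x, w) \<in> parcs G}"
  have "(x, w) \<in> parcs G \<and> col w = c \<longleftrightarrow>
      w \<in> T \<and> \<gamma> w = c \<or> c = 0 \<and> (x, w) \<in> parcs G \<and> w \<notin> T" for w
    using T assms(3,4)[of w] by (cases "w \<in> T") auto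
  then have "{w. (x, w) \<in> parcs G \<and> col w = c} = {l \<in> T. \<gamma> l = c} \<union> (if c = 0 then ?N - T else {})"
    by auto
  then have "nbr_count G (x, col) c = card ({l \<in> T. \<gamma> l = c} \<union> (if c = 0 then ?N - T else {}))"
    by (simp add: nbr_count_def)
  also have "\<dots> = card {l \<in> T. \<gamma> l = c} + card (if c = 0 then ?N - T else {})"
    using fin T by (intro card_Un_disjoint) (auto intro: finite_subset)
  also have "card (if c = 0 then ?N - T else {}) = (if c = 0 then card ?N - card T else 0)"
    using card_Diff_subset[OF finite_subset[OF T fin] T] by simp
  finally show "nbr_count G (x, col) c = env \<gamma> T (card ?N) c" by (simp add: env_def)
qed

lemma (in leafy) U_arc:
  assumes "j \<le> M" "i \<in> U j"
  shows "(i, j) \<in> parcs G" "(j, i) \<in> parcs G"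
  using assms U_less[OF assms] core_in_G[of i] core_in_G[of j] by (simp_all add: parcs_G)

locale leafy_walk = leafy +
  fixes move :: algorithm and C :: "nat set" and \<gamma> :: "nat \<Rightarrow> nat"
  assumes valid: "valid_algorithm move"
    and start: "wins move C G 0 {0} (0, \<lambda>_. 0)"
begin

text \<open>
  When the agent first reaches \<open>j\<close>, it may already have visited leaves, but only of core vertices
  not adjacent to \<open>j\<close>: at neighbours of \<open>j\<close> the adversary prefers \<open>j\<close> to uncoloured leaves.
\<close>

definition explored :: "nat \<Rightarrow> nat set" where
  "explored j = {..<j} \<union> (\<Union>i\<in>{..<j} - U j. leaves i)"

definition fresh_col :: "nat \<Rightarrow> (nat \<Rightarrow> nat) \<Rightarrow> bool" where
  "fresh_col j col \<longleftrightarrow> (\<forall>i<j. col i = \<gamma> i) \<and> (\<forall>x. x \<notin> explored j \<longrightarrow> col x = 0)"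

definition fresh_at :: "nat \<Rightarrow> bool" where
  "fresh_at j \<longleftrightarrow> (\<exists>V col. wins move C G 0 V (j, col) \<and> V \<subseteq> insert j (explored j) \<and> fresh_col j col)"

lemma exploredE:
  assumes "x \<in> explored j"
  obtains "x < j" | i where "i < j" "i \<notin> U j" "x \<in> leaves i"
  using assms by (auto simp: explored_def)

lemma core_not_explored: "x \<le> M \<Longrightarrow> j \<le> x \<Longrightarrow> x \<notin> explored j"
  using leaves_gt by (fastforce elim: exploredE)

lemma leaves_not_explored:
  assumes "j \<le> M" "x \<in> leaves i" "j \<le> i \<or> i \<in> U j"
  shows "x \<notin> explored j"
proof
  assume "x \<in> explored j"
  then show False
  proof (cases rule: exploredE)
    case 1
    then show ?thesis using leaves_gt[OF assms(2)] assms(1) by simp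
  next
    case (2 i')
    then show ?thesis using leaves_disjoint[OF assms(2) 2(3)] assms(3) by auto
  qed
qed

lemma explored_Suc: "Suc j \<le> M \<Longrightarrow> insert j (explored j) \<subseteq> explored (Suc j)"
  using U_chord[of _ j "Suc j"] by (fastforce simp: explored_def)

text \<open>This lets the adversary redirect the agent: unexplored vertices are uncoloured, so any
  exit from the explored part can be answered with \<open>j\<close> itself.\<close>

lemma nbrs_explored:
  assumes "x \<in> explored j" "j \<le> M" "(x, y) \<in> parcs G" "y \<notin> explored j"
  shows "x \<in> U j \<and> x < j"
  using assms(1)
proof (cases rule: exploredE)
  case 1
  then have xM: "x \<le> M" using assms(2) by simp
  then consider "y \<in> leaves x" | "y \<le> M" "y \<in> U x" | "y \<le> M" "x \<in> U y"
    using nbrs_core[OF xM] assms(3) by (auto simp: core_nbrs_def)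
  then show ?thesis
  proof cases
    case 1
    then show ?thesis using assms(4) \<open>x < j\<close> by (auto simp: explored_def)
  next
    case 2
    then have "y < j" using U_less[OF xM, of y] \<open>x < j\<close> by simp
    then show ?thesis using assms(4) by (auto simp: explored_def)
  next
    case 3
    have "j \<le> y" using assms(4) by (auto simp: explored_def)
    then show ?thesis using 3 U_chord[of x j y] \<open>x < j\<close> by (cases "y = j") auto
  qed
next
  case (2 i)
  then have "y = i" using nbrs_leaf assms(3) by blast
  then show ?thesis using 2 assms(4) by (auto simp: explored_def)
qed

text \<open>The leaves of \<open>j\<close> and its later neighbours are still uncoloured and the
  padding fixes the degree, so the agent sees nothing of the rest of the graph.\<close>

lemma nbr_count_fresh:
  assumes "j \<le> M" "fresh_col j col"
  shows "nbr_count G (j, col) = env \<gamma> (U j) (D j)"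
proof -
  have sub: "U j \<subseteq> nbrs j"
    using U_less[OF assms(1)] assms(1) by (auto simp: nbrs_core core_nbrs_def)
      (metis U_less assms(1) le_trans less_imp_le)
  have zero: "col w = 0" if w: "w \<in> nbrs j" "w \<notin> U j" for w
  proof -
    consider "w \<in> leaves j" | "w \<le> M" "j \<in> U w"
      using w nbrs_core[OF assms(1)] by (auto simp: core_nbrs_def)
    then have "w \<notin> explored j"
    proof cases
      case 1
      then show ?thesis using leaves_not_explored[OF assms(1)] by blast
    next
      case 2
      then show ?thesis using U_less[of w j] core_not_explored[of w j] by simp
    qed
    then show ?thesis using assms(2) by (simp add: fresh_col_def)
  qed
  have "nbr_count G (j, col) = env \<gamma> (U j) (card (nbrs j))"
    by (rule nbr_count_env)
      (use assms(2) sub zero U_less[OF assms(1)] finite_neighbours[OF pair_graph_G]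
        in \<open>auto simp: fresh_col_def\<close>)
  then show ?thesis by (simp add: card_nbrs assms(1))
qed

lemma decide_fresh:
  assumes "j \<le> M" "fresh_col j col"
  shows "decide move G (j, col) = move 0 (env \<gamma> (U j) (D j))"
  using nbr_count_fresh[OF assms] core_not_explored[OF assms(1) order_refl] assms(2)
  by (simp add: decide_def fresh_col_def)

lemma fresh_at_0: "fresh_at 0"
  unfolding fresh_at_def fresh_col_def using start
  by (intro exI[of _ "{0}"] exI[of _ "\<lambda>_. 0"]) auto

text \<open>As \<open>Suc j\<close> is unvisited, the agent must eventually leave
  \<open>explored (Suc j)\<close>, and each exit can be redirected to \<open>Suc j\<close>. Nonzero
  colours are permanent, so the earlier vertices keep theirs meanwhile.\<close>

lemma fresh_at_Suc:
  assumes fresh: "fresh_at j" and j: "Suc j \<le> M" and nz: "\<And>i. i \<le> j \<Longrightarrow> \<gamma> i \<noteq> 0"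
    and \<gamma>: "\<gamma> j = new_colour (move 0 (env \<gamma> (U j) (D j)))"
  shows "fresh_at (Suc j)"
proof -
  let ?Z = "explored (Suc j)"
  obtain V col where win: "wins move C G 0 V (j, col)"
    and V: "V \<subseteq> insert j (explored j)" and col: "fresh_col j col"
    using fresh unfolding fresh_at_def by blast
  \<comment> \<open>The second alternative is the moment of arrival, when \<open>j\<close> has not
    yet received its colour.\<close>
  define Inv where "Inv V x col \<longleftrightarrow> x \<in> ?Z \<and> V \<subseteq> ?Z \<and>
    (fresh_col (Suc j) col \<or> x = j \<and> fresh_col j col)" for V x and col :: "nat \<Rightarrow> nat"
  define Q where "Q V x col \<longleftrightarrow> x = Suc j \<and> V \<subseteq> insert (Suc j) ?Z \<and> fresh_col (Suc j) col"
    for V x and col :: "nat \<Rightarrow> nat"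
  have notin: "Suc j \<notin> ?Z" using core_not_explored[OF j order_refl] .
  have "\<exists>V' x' col'. wins move C G 0 V' (x', col') \<and> Q V' x' col'"
  proof (rule wins_until[where Inv = Inv and Q = Q, OF valid pair_graph_G win])
    show "Inv V j col"
      using V col explored_Suc[OF j] by (auto simp: Inv_def)
  next
    fix V x and col :: "nat \<Rightarrow> nat"
    assume "Inv V x col" "pverts G \<subseteq> V"
    then show False using core_in_G[OF j] notin by (auto simp: Inv_def)
  next
    fix V x c d and col :: "nat \<Rightarrow> nat"
    assume inv: "Inv V x col" and dec: "decide move G (x, col) = Go c d"
      and c: "col x \<noteq> 0 \<Longrightarrow> c = col x" and ex: "\<exists>y. (x, y) \<in> parcs G \<and> col y = d"
    have xZ: "x \<in> ?Z" and VZ: "V \<subseteq> ?Z" using inv by (auto simp: Inv_def)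
    have zero: "col y = 0" if "y \<notin> ?Z" for y
      using inv that explored_Suc[OF j] by (auto simp: Inv_def fresh_col_def)
    have col': "fresh_col (Suc j) (col(x := c))"
    proof -
      have "x = j \<Longrightarrow> fresh_col j col \<Longrightarrow> c = \<gamma> j"
        using dec decide_fresh[of j col] j \<gamma> by simp
      then have "(col(x := c)) i = \<gamma> i" if "i < Suc j" for i
        using inv that c nz[of i] by (auto simp: Inv_def fresh_col_def less_Suc_eq)
      then show ?thesis using zero xZ by (auto simp: fresh_col_def)
    qed
    obtain y where y: "(x, y) \<in> parcs G" "col y = d" using ex by blast
    show "\<exists>y. (x, y) \<in> parcs G \<and> col y = d \<and>
        (Inv (insert y V) y (col(x := c)) \<or> Q (insert y V) y (col(x := c)))"
    proof (cases "y \<in> ?Z")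
      case True
      then show ?thesis using y col' VZ by (intro exI[of _ y]) (simp add: Inv_def)
    next
      case False
      then have "x \<in> U (Suc j)" "x < Suc j" using nbrs_explored[OF xZ j y(1)] by auto
      then have "(x, Suc j) \<in> parcs G"
        using nbrs_core[of x] j by (auto simp: core_nbrs_def)
      then show ?thesis
        using y(2) zero[OF False] zero[OF notin] col' VZ by (intro exI[of _ "Suc j"]) (auto simp: Q_def)
    qed
  qed
  then show ?thesis unfolding fresh_at_def Q_def by blast
qed

lemma fresh_colour:
  assumes "fresh_at j" "j \<le> M" "z \<in> pverts G" "z \<notin> insert j (explored j)"
  shows "new_colour (move 0 (env \<gamma> (U j) (D j))) \<in> insert 0 C"
proof -
  obtain V col where win: "wins move C G 0 V (j, col)"
    and V: "V \<subseteq> insert j (explored j)" and col: "fresh_col j col"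
    using assms(1) unfolding fresh_at_def by blast
  from win show ?thesis
  proof cases
    case stop
    then show ?thesis using V assms(3,4) by auto
  next
    case (go c d)
    then show ?thesis using decide_fresh[OF assms(2) col] by simp
  qed
qed

text \<open>\<open>M\<close> is a twin of \<open>N\<close>: while both are uncoloured they see the
  same. An agent that leaves \<open>N\<close> uncoloured does the same at \<open>M\<close>, and any
  move beyond them and the explored part can be redirected to one of the two, so no leaf of
  \<open>N\<close> is ever visited.\<close>

lemma fresh_coloured:
  assumes M: "M = Suc N" and twin: "U M = insert N (U N)" "D M = D N" and leaf: "leaves N \<noteq> {}"
    and fresh: "fresh_at N" and nz: "\<And>i. i < N \<Longrightarrow> \<gamma> i \<noteq> 0"
  shows "new_colour (move 0 (env \<gamma> (U N) (D N))) \<noteq> 0"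
proof
  assume zero: "new_colour (move 0 (env \<gamma> (U N) (D N))) = 0"
  obtain V col where win: "wins move C G 0 V (N, col)"
    and V: "V \<subseteq> insert N (explored N)" and col: "fresh_col N col"
    using fresh unfolding fresh_at_def by blast
  let ?Z = "insert N (insert M (explored N))"
  have NM: "N \<le> M" "N < M" using M by auto
  have NMarc: "(N, M) \<in> parcs G" "(M, N) \<in> parcs G"
    using nbrs_core[of N] nbrs_core[of M] twin NM by (auto simp: core_nbrs_def)
  obtain z where z: "z \<in> leaves N" using leaf by blast
  have zZ: "z \<notin> ?Z"
    using leaves_not_explored[OF NM(1) z] leaves_gt[OF z] NM by auto
  define Inv where "Inv V x col \<longleftrightarrow> x \<in> ?Z \<and> V \<subseteq> ?Z \<and> fresh_col N col"
    for V x and col :: "nat \<Rightarrow> nat"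
  have twin_decide: "decide move G (M, col) = move 0 (env \<gamma> (U N) (D N))"
    if col: "fresh_col N col" for col
  proof -
    have "core_nbrs M U M = U M"
      using U_less[of M] U_less[of _ M] by (auto simp: core_nbrs_def) (meson less_imp_le not_le)+
    then have nb: "nbrs M = insert N (U N) \<union> leaves M"
      using nbrs_core[of M] twin by simp
    have out: "w \<notin> explored N" if "w \<in> insert N (leaves M)" for w
      using that leaves_not_explored[OF NM(1), of w M] core_not_explored[OF NM(1)] NM by auto
    have zero: "col w = 0" if w: "w \<in> nbrs M" "w \<notin> U N" for w
    proof -
      have "w \<in> insert N (leaves M)" using w unfolding nb by blast
      from out[OF this] show ?thesis using col by (simp add: fresh_col_def)
    qed
    have "nbr_count G (M, col) = env \<gamma> (U N) (card (nbrs M))"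
    proof (rule nbr_count_env)
      show "U N \<subseteq> nbrs M" unfolding nb by blast
      show "col w = \<gamma> w" if "w \<in> U N" for w
        using col U_less[OF NM(1) that] by (simp add: fresh_col_def)
      show "finite (nbrs M)" by (rule finite_neighbours[OF pair_graph_G])
      show "col w = 0" if "(M, w) \<in> parcs G" "w \<notin> U N" for w
        using zero that by blast
    qed
    moreover have "col M = 0"
      using col core_not_explored[of M N] NM by (simp add: fresh_col_def)
    ultimately show ?thesis by (simp add: decide_def card_nbrs twin)
  qed
  show False
  proof (rule wins_trap[where Inv = Inv, OF valid pair_graph_G win])
    show "Inv V N col"
      using V col by (auto simp: Inv_def)
  next
    fix V x and col :: "nat \<Rightarrow> nat"
    assume "Inv V x col" "pverts G \<subseteq> V"
    then show False using z zZ by (auto simp: Inv_def leaves_def)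
  next
    fix V x c d and col :: "nat \<Rightarrow> nat"
    assume inv: "Inv V x col" and dec: "decide move G (x, col) = Go c d"
      and c: "col x \<noteq> 0 \<Longrightarrow> c = col x" and ex: "\<exists>y. (x, y) \<in> parcs G \<and> col y = d"
    have xZ: "x \<in> ?Z" and VZ: "V \<subseteq> ?Z" and col: "fresh_col N col"
      using inv by (auto simp: Inv_def)
    have out: "col y = 0" if "y \<notin> explored N" for y
      using that col by (simp add: fresh_col_def)
    have "c = 0" if "x = N \<or> x = M"
      using that dec decide_fresh[OF NM(1) col] twin_decide[OF col] zero by auto
    then have col': "fresh_col N (col(x := c))"
      using col xZ c nz by (auto simp: fresh_col_def)
    obtain y where y: "(x, y) \<in> parcs G" "col y = d" using ex by blast
    have "\<exists>y\<in>?Z. (x, y) \<in> parcs G \<and> col y = d"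
    proof (cases "y \<in> ?Z")
      case False
      then have d: "d = 0" using out y by auto
      consider "x = N" | "x = M" | "x \<in> explored N" using xZ by auto
      then show ?thesis
      proof cases
        case 1
        then show ?thesis
          using NMarc d out[of M] core_not_explored[of M N] NM by auto
      next
        case 2
        then show ?thesis
          using NMarc d out[of N] core_not_explored[of N N] NM by auto
      next
        case 3
        then have "x \<in> U N" using nbrs_explored[OF 3 NM(1) y(1)] False by auto
        then have "(x, N) \<in> parcs G" by (rule U_arc[OF NM(1)])
        then show ?thesis
          using d out[of N] core_not_explored[of N N] NM by auto
      qed
    qed (use y in auto)
    then show "\<exists>y. (x, y) \<in> parcs G \<and> col y = d \<and> Inv (insert y V) y (col(x := c))"
      using col' VZ unfolding Inv_def by blast
  qed
qed

end

section \<open>Agents trapped below a cut vertex\<close>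

lemma decide_cong:
  assumes "\<And>w. (x, w) \<in> parcs G \<Longrightarrow> col w = col' w" "col x = col' x"
  shows "decide move G (x, col) = decide move G (x, col')"
proof -
  have "{w. (x, w) \<in> parcs G \<and> col w = c} = {w. (x, w) \<in> parcs G \<and> col' w = c}" for c
    using assms(1) by auto
  then have "nbr_count G (x, col) = nbr_count G (x, col')" by (intro ext) (simp add: nbr_count_def)
  then show ?thesis using assms(2) by (simp add: decide_def)
qed

context leafy_walk
begin

text \<open>
  The last core vertex \<open>M\<close> sees only the cut vertex \<open>b\<close> and \<open>N\<close>, and a leaf of \<open>N\<close> is still
  unvisited. If the agent moves on to \<open>b\<close> then it can never finish: either \<open>b\<close> sends it back below
  \<open>b\<close>, and then always does so because its environment does not change while the agent stays
  there, or the agent never returns below \<open>b\<close>.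
\<close>

lemma link_avoids_root:
  assumes M: "M = Suc N" and UM: "U M = {b, N}" and DM: "D M = 2" and b: "0 < b" "b < N"
    and cut: "\<And>i l. i < b \<Longrightarrow> b < l \<Longrightarrow> l \<le> M \<Longrightarrow> i \<notin> U l"
    and fresh: "fresh_at M" and nz: "\<And>i. i \<le> N \<Longrightarrow> \<gamma> i \<noteq> 0" and leaf: "leaves N \<noteq> {}"
  obtains c d where "move 0 (env \<gamma> {b, N} 2) = Go c d" "d \<in> {\<gamma> b, \<gamma> N}" "d \<noteq> \<gamma> b"
proof -
  obtain V col where win: "wins move C G 0 V (M, col)"
    and V: "V \<subseteq> insert M (explored M)" and col: "fresh_col M col"
    using fresh unfolding fresh_at_def by blast
  obtain z where z: "z \<in> leaves N" using leaf by blast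
  have zM: "z \<notin> insert M (explored M)"
    using leaves_not_explored[OF order_refl z] UM leaves_gt[OF z] by auto
  have zG: "z \<in> pverts G" using z by (simp add: leaves_def)
  have core_M: "core_nbrs M U M = {b, N}"
  proof -
    have "M \<notin> U l" if "l \<le> M" for l using U_less[OF that, of M] that by auto
    then show ?thesis using b M UM by (auto simp: core_nbrs_def)
  qed
  have "leaves M = {}" using card_leaves[of M] finite_leaves[of M] core_M DM b by simp
  then have nbrs_M: "nbrs M = {b, N}" using nbrs_core[of M] core_M by simp
  have decide_M: "decide move G (M, col) = move 0 (env \<gamma> {b, N} 2)"
    if "col b = \<gamma> b" "col N = \<gamma> N" "col M = 0" for col
  proof -
    have "nbr_count G (M, col) = env \<gamma> {b, N} (card (nbrs M))"
    proof (rule nbr_count_env)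
      show "finite (nbrs M)" by (rule finite_neighbours[OF pair_graph_G])
      show "{b, N} \<subseteq> nbrs M" by (simp only: nbrs_M order_refl)
      show "col w = \<gamma> w" if "w \<in> {b, N}" for w using that \<open>col b = \<gamma> b\<close> \<open>col N = \<gamma> N\<close> by auto
      show "col w = 0" if "(M, w) \<in> parcs G" "w \<notin> {b, N}" for w using that nbrs_M by blast
    qed
    then show ?thesis using that(3) DM card_nbrs[of M] by (simp add: decide_def)
  qed
  have col_core: "col i = \<gamma> i" if "i < M" for i
    using that col by (simp add: fresh_col_def)
  have col_M: "col M = 0"
    using col core_not_explored[of M M] by (simp add: fresh_col_def)
  have dec: "decide move G (M, col) = move 0 (env \<gamma> {b, N} 2)"
    using decide_M col_core col_M b M by simp
  obtain c d where go: "decide move G (M, col) = Go c d"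
    and next_win: "\<And>s'. adversary_step move G (M, col) s' \<Longrightarrow> wins move C G 0 (insert (fst s') V) s'"
    using win
  proof cases
    case stop
    then show ?thesis using zM zG V by auto
  next
    case (go c d)
    then show ?thesis using that by blast
  qed
  obtain y where "(M, y) \<in> parcs G" "col y = d"
    using Go_neighbour[OF valid pair_graph_G go] by auto
  then have "y \<in> {b, N}" "col y = d" using nbrs_M by blast+
  then have d: "d \<in> {\<gamma> b, \<gamma> N}" using col_core b M by auto
  have "d \<noteq> \<gamma> b"
  proof
    assume db: "d = \<gamma> b"
    let ?P = "side b"
    have bM: "(M, b) \<in> parcs G" using nbrs_M by blast
    have "adversary_step move G (M, col) (b, col(M := c))"
      using go bM db col_core b M by (simp add: adversary_step_def)
    from next_win[OF this] have win': "wins move C G 0 (insert b V) (b, col(M := c))" by simp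
    have zP: "z \<in> ?P" using leaves_side[OF z] b by simp
    have b_notin: "b \<notin> ?P" using core_side[of b b] b M by simp
    have closed: "y \<in> insert b ?P" if "x \<in> ?P" "(x, y) \<in> parcs G" for x y
      using side_closed[OF cut that] by blast
    \<comment> \<open>Leaves of \<open>b\<close> are outside \<open>side b\<close>, so the
      neighbours of \<open>b\<close> inside are core vertices, whose colours \<open>K\<close> fixes.
      Hence the environment of \<open>b\<close> does not change while the agent is inside.\<close>
    have core_below: "w \<le> M" if "(b, w) \<in> parcs G" "w \<in> ?P" for w
    proof (rule ccontr)
      assume "\<not> w \<le> M"
      then have "w \<in> leaves b" using nbrs_core[of b] that(1) b M by (auto simp: core_nbrs_def)
      then show False using leaves_side[of w b b] that(2) by simp
    qed
    define K where "K col \<longleftrightarrow> (\<forall>i<M. col i = \<gamma> i) \<and> col M = c" for col :: "nat \<Rightarrow> nat"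
    define Out where "Out V x col \<longleftrightarrow> x \<notin> ?P \<and> z \<notin> V \<and> K col"
      for V x and col :: "nat \<Rightarrow> nat"
    \<comment> \<open>The witness \<open>w\<close> guarantees that the adversary can answer the
      decision at \<open>b\<close> inside \<open>side b\<close>.\<close>
    define Below where "Below x col \<longleftrightarrow> x \<in> insert b ?P \<and> K col \<and>
      (\<exists>c' w. decide move G (b, col) = Go c' (col w) \<and> w \<in> ?P \<and> (b, w) \<in> parcs G)"
      for x and col :: "nat \<Rightarrow> nat"
    have K_step: "col(x := c1) = col" if K: "K col" "x \<le> M" and go1: "decide move G (x, col) = Go c1 d1"
      and c1: "col x \<noteq> 0 \<Longrightarrow> c1 = col x" for x c1 d1 and col :: "nat \<Rightarrow> nat"
    proof (cases "col x = 0")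
      case True
      \<comment> \<open>\<open>M\<close> may have been left uncoloured (\<open>c = 0\<close>); then
        it sees the same two colours again and repeats its decision.\<close>
      then have "x = M" using K nz[of x] M by (cases "x = M") (auto simp: K_def)
      moreover have "decide move G (M, col) = Go c d"
        using decide_M[of col] K b M True \<open>x = M\<close> go dec by (simp add: K_def)
      ultimately show ?thesis using K go1 by (auto simp: K_def)
    next
      case False
      then show ?thesis using c1 by auto
    qed
    show False
    proof (rule wins_trap[where Inv = "\<lambda>V x col. Out V x col \<or> Below x col",
          OF valid pair_graph_G win'])
      have "z \<notin> insert b V" using V zM zP b_notin by auto
      then show "Out (insert b V) b (col(M := c)) \<or> Below b (col(M := c))"
        using b_notin col_core by (auto simp: Out_def K_def)
    next
      fix V x and col :: "nat \<Rightarrow> nat"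
      assume "Out V x col \<or> Below x col" "x = 0" "pverts G \<subseteq> V"
      then show False using zG b core_side[of 0 b] by (auto simp: Out_def Below_def)
    next
      fix V x c1 d1 and col :: "nat \<Rightarrow> nat"
      assume inv: "Out V x col \<or> Below x col" and go1: "decide move G (x, col) = Go c1 d1"
        and c1: "col x \<noteq> 0 \<Longrightarrow> c1 = col x" and ex: "\<exists>y. (x, y) \<in> parcs G \<and> col y = d1"
      have K: "K col" using inv by (auto simp: Out_def Below_def)
      note K_step = K_step[OF K _ go1 c1]
      obtain y where y: "(x, y) \<in> parcs G" "col y = d1" using ex by blast
      from inv show "\<exists>y. (x, y) \<in> parcs G \<and> col y = d1 \<and>
          (Out (insert y V) y (col(x := c1)) \<or> Below y (col(x := c1)))"
      proof
        assume below: "Below x col"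
        then obtain c' w where w: "decide move G (b, col) = Go c' (col w)" "w \<in> ?P" "(b, w) \<in> parcs G"
          by (auto simp: Below_def)
        have K': "K (col(x := c1))" and dec': "decide move G (b, col(x := c1)) = Go c' ((col(x := c1)) w)"
        proof -
          have "K (col(x := c1)) \<and> decide move G (b, col(x := c1)) = Go c' ((col(x := c1)) w)"
          proof (cases "x \<le> M")
            case True
            then show ?thesis using K_step K w by simp
          next
            case False
            then have "x \<in> ?P" using below b M by (auto simp: Below_def)
            then have nb: "(b, x) \<notin> parcs G" using core_below[of x] False by blast
            then have "decide move G (b, col(x := c1)) = decide move G (b, col)"
              using False b M by (intro decide_cong) auto
            moreover have "w \<noteq> x" using w(3) nb by blast
            moreover have "K (col(x := c1))" using K False by (simp add: K_def)
            ultimately show ?thesis using w(1) by simp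
          qed
          then show "K (col(x := c1))"
            "decide move G (b, col(x := c1)) = Go c' ((col(x := c1)) w)" by blast+
        qed
        have "\<exists>y. (x, y) \<in> parcs G \<and> col y = d1 \<and> y \<in> insert b ?P"
        proof (cases "x = b")
          case True
          then show ?thesis using w go1 by auto
        next
          case False
          then show ?thesis using below closed[of x y] y by (auto simp: Below_def)
        qed
        then show ?thesis using K' dec' w(2,3) unfolding Below_def by blast
      next
        assume out: "Out V x col"
        have K': "K (col(x := c1))"
        proof (cases "x \<le> M")
          case True
          then show ?thesis using K_step K by simp
        next
          case False
          then show ?thesis using K by (simp add: K_def)
        qed
        show ?thesis
        proof (cases "y \<in> ?P")
          case True
          then have "x = b" using closed[OF True G_sym[OF y(1)]] out by (auto simp: Out_def)
          then have "col(x := c1) = col" using K_step b M by simp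
          then have "Below y (col(x := c1))"
            using True K y go1 \<open>x = b\<close> unfolding Below_def by auto
          then show ?thesis using y by blast
        next
          case False
          then have "Out (insert y V) y (col(x := c1))"
            using out K' zP by (auto simp: Out_def)
          then show ?thesis using y by blast
        qed
      qed
    qed
  qed
  then show ?thesis using that[of c d] go dec d by simp
qed

end

section \<open>Colours within a clique\<close>

text \<open>The vertices from \<open>b\<close> to \<open>N\<close> are the last clique. The extra
  vertex \<open>M\<close> is a pendant at \<open>N\<close>, so it acts as one more leaf of
  \<open>N\<close>.\<close>

locale clique_end = leafy_walk +
  fixes N b :: nat
  assumes M_eq: "M = Suc N" and U_M: "U M = {N}" and D_M: "D M = 1"
    and block: "\<And>j. b < j \<Longrightarrow> j \<le> N \<Longrightarrow> U j = {b..<j}"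
    and nonzero: "\<And>i. i \<le> N \<Longrightarrow> \<gamma> i \<noteq> 0"
begin

definition own :: "nat \<Rightarrow> nat set" where
  "own f = nbrs f - {b..N}"

lemma arc_irrefl: "(x, x) \<notin> parcs G"
proof -
  interpret pair_graph G by (rule pair_graph_G)
  show ?thesis using pair_no_loops[of "(x, x)"] by auto
qed

lemma clique_arc: "x \<in> {b..N} \<Longrightarrow> y \<in> {b..N} \<Longrightarrow> x \<noteq> y \<Longrightarrow> (x, y) \<in> parcs G"
  using U_arc[of x y] U_arc[of y x] block[of x] block[of y] M_eq
  by (cases x y rule: linorder_cases) auto

lemma nbrs_M: "nbrs M = {N}"
proof -
  have "M \<notin> U l" if "l \<le> M" for l using U_less[OF that, of M] that by auto
  then have core: "core_nbrs M U M = {N}" using M_eq U_M by (auto simp: core_nbrs_def)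
  then have "leaves M = {}" using card_leaves[of M] finite_leaves[of M] D_M by simp
  then show ?thesis using nbrs_core[of M] core by simp
qed

lemma own_cases:
  assumes f: "b < f" "f \<le> N" and y: "y \<in> own f"
  shows "y \<in> leaves f \<or> y = M \<and> f = N"
proof (rule ccontr)
  assume not: "\<not> ?thesis"
  have "y \<in> core_nbrs M U f"
  proof -
    have "f \<le> M" using f M_eq by simp
    then have "y \<in> core_nbrs M U f \<union> leaves f" using y nbrs_core unfolding own_def by blast
    then show ?thesis using not by simp
  qed
  then have yM: "y \<le> M" "y \<in> U f \<or> f \<in> U y" by (auto simp: core_nbrs_def)
  have "y \<notin> U f" using y block[OF f] f by (auto simp: own_def)
  then have fy: "f \<in> U y" using yM by simp
  then have "f < y" using U_less yM(1) by blast
  moreover have "y \<notin> {b..N}" using y by (simp add: own_def)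
  ultimately have "y = M" using f yM(1) M_eq by simp
  then show False using fy U_M not by simp
qed

lemma nbrs_own: "b < f \<Longrightarrow> f \<le> N \<Longrightarrow> y \<in> own f \<Longrightarrow> nbrs y = {f}"
  using own_cases[of f y] nbrs_leaf[of y f] nbrs_M by auto

lemma own_gt: "b < f \<Longrightarrow> f \<le> N \<Longrightarrow> y \<in> own f \<Longrightarrow> N < y"
  using own_cases[of f y] leaves_gt[of y f] M_eq by auto

lemma own_in_G: "y \<in> own f \<Longrightarrow> y \<in> pverts G"
  by (simp add: own_def parcs_G)

lemma finite_own: "finite (own f)"
  unfolding own_def using finite_neighbours[OF pair_graph_G, of f] by simp

lemma card_own:
  assumes "b < f" "f \<le> N"
  shows "card (own f) = D f - (N - b)"
proof -
  have "{b..N} - {f} \<subseteq> nbrs f" using clique_arc[of f] assms by auto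
  moreover have "own f = nbrs f - ({b..N} - {f})"
    using arc_irrefl by (auto simp: own_def)
  moreover have "card ({b..N} - {f}) = N - b" using assms by simp
  ultimately show ?thesis
    using card_Diff_subset[of "{b..N} - {f}" "nbrs f"] card_nbrs[of f] assms M_eq by simp
qed

text \<open>
  The environment of \<open>f\<close> once the clique is coloured: all its private neighbours are leaves, so \<open>t\<close>
  of them have the colour \<open>e\<close> that a leaf receives, and the rest is uncoloured.
\<close>

definition clique_env :: "nat \<Rightarrow> nat \<Rightarrow> nat \<Rightarrow> nat \<Rightarrow> nat \<Rightarrow> nat" where
  "clique_env a e q t = (\<lambda>z. (card {l \<in> {b..N}. \<gamma> l = z} - (if a = z then 1 else 0))
     + (if z = e then t else 0) + (if z = 0 then q - t else 0))"

definition marked :: "(nat \<Rightarrow> nat) \<Rightarrow> nat \<Rightarrow> nat" where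
  "marked col f = card {y \<in> own f. col y \<noteq> 0}"

lemma decide_clique:
  assumes f: "b < f" "f \<le> N" and col: "\<And>i. i \<le> N \<Longrightarrow> col i = \<gamma> i"
    and own: "\<And>y. y \<in> own f \<Longrightarrow> col y \<in> {0, e}"
  shows "decide move G (f, col) = move (\<gamma> f) (clique_env (\<gamma> f) e (card (own f)) (marked col f))"
proof -
  have "nbr_count G (f, col) z = clique_env (\<gamma> f) e (card (own f)) (marked col f) z" for z
  proof -
    let ?A = "{l \<in> {b..N} - {f}. \<gamma> l = z}" and ?B = "{y \<in> own f. col y = z}"
    have arc: "(f, w) \<in> parcs G \<longleftrightarrow> w \<in> {b..N} - {f} \<or> w \<in> own f" for w
      using clique_arc[of f w] f arc_irrefl[of f] by (auto simp: own_def)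
    have "{w. (f, w) \<in> parcs G \<and> col w = z} = ?A \<union> ?B"
      using arc col by auto
    moreover have "?A \<inter> ?B = {}" by (auto simp: own_def)
    ultimately have "nbr_count G (f, col) z = card ?A + card ?B"
      by (simp add: nbr_count_def card_Un_disjoint finite_own)
    moreover have "card ?A = card {l \<in> {b..N}. \<gamma> l = z} - (if \<gamma> f = z then 1 else 0)"
    proof (cases "\<gamma> f = z")
      case True
      then have "?A = {l \<in> {b..N}. \<gamma> l = z} - {f}" "f \<in> {l \<in> {b..N}. \<gamma> l = z}" using f by auto
      then show ?thesis using True by (simp add: card_Diff_singleton)
    next
      case False
      then have "?A = {l \<in> {b..N}. \<gamma> l = z}" by auto
      then show ?thesis using False by simp
    qed
    moreover have "card ?B = (if z = e then marked col f else 0) + (if z = 0 then card (own f) - marked col f else 0)"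
    proof -
      have zero: "card {y \<in> own f. col y = 0} = card (own f) - marked col f"
      proof -
        have "{y \<in> own f. col y = 0} = own f - {y \<in> own f. col y \<noteq> 0}" by auto
        then show ?thesis unfolding marked_def by (simp add: card_Diff_subset finite_own)
      qed
      \<comment> \<open>Leaves may remain uncoloured: if \<open>e = 0\<close>, nothing is ever
        marked.\<close>
      consider "z = 0" "e = 0" | "z = 0" "e \<noteq> 0" | "z = e" "z \<noteq> 0" | "z \<noteq> 0" "z \<noteq> e" by blast
      then show ?thesis
      proof cases
        case 1
        then have "marked col f = 0" using own by (auto simp: marked_def finite_own)
        then show ?thesis using zero 1 by simp
      next
        case 2
        then show ?thesis using zero by simp
      next
        case 3
        then have "?B = {y \<in> own f. col y \<noteq> 0}" using own by fastforce
        then show ?thesis using 3 by (simp add: marked_def)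
      next
        case 4
        then have none: "?B = {}" using own by fastforce
        show ?thesis unfolding none using 4 by simp
      qed
    qed
    ultimately show ?thesis by (simp add: clique_env_def)
  qed
  then have "nbr_count G (f, col) = clique_env (\<gamma> f) e (card (own f)) (marked col f)" by blast
  then show ?thesis using col f by (simp add: decide_def)
qed

lemma marked_colour:
  assumes "y \<in> own f" "col y = 0"
  shows "marked (col(y := c)) f = (if c = 0 then marked col f else Suc (marked col f))"
proof (cases "c = 0")
  case True
  then have "col(y := c) = col" using assms(2) by auto
  then show ?thesis using True by simp
next
  case False
  then have "{x \<in> own f. (col(y := c)) x \<noteq> 0} = insert y {x \<in> own f. col x \<noteq> 0}"
    using assms by auto
  then show ?thesis using False assms by (simp add: marked_def finite_own)
qed

lemma marked_other: "y \<notin> own f \<Longrightarrow> marked (col(y := c)) f = marked col f"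
  unfolding marked_def by (rule arg_cong[where f = card]) auto

text \<open>A pendant vertex sees one neighbour only, so the private neighbours of equally coloured
  vertices all get the same colour, possibly 0.\<close>

definition leaf_colour :: "nat \<Rightarrow> nat" where
  "leaf_colour a = new_colour (move 0 (\<lambda>z. if z = a then 1 else 0))"

lemma decide_own:
  assumes f: "b < f" "f \<le> N" and y: "y \<in> own f" and col: "col f = \<gamma> f" "col y = 0"
  shows "new_colour (decide move G (y, col)) = leaf_colour (\<gamma> f)"
proof -
  have "{w. (y, w) \<in> parcs G \<and> col w = z} = (if z = \<gamma> f then {f} else {})" for z
    using nbrs_own[OF f y] col(1) by auto
  then have "nbr_count G (y, col) = (\<lambda>z. if z = \<gamma> f then 1 else 0)"
    by (intro ext) (simp add: nbr_count_def)
  then show ?thesis using col(2) by (simp add: decide_def leaf_colour_def)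
qed

definition settled :: "(nat \<Rightarrow> nat) \<Rightarrow> bool" where
  "settled col \<longleftrightarrow> (\<forall>i\<le>N. col i = \<gamma> i)"

lemma settled_step:
  assumes "settled col" "col x \<noteq> 0 \<Longrightarrow> c = col x"
  shows "settled (col(x := c))"
  using assms nonzero by (auto simp: settled_def)

lemma settled_core:
  assumes "settled col" "x \<le> N" "col x \<noteq> 0 \<Longrightarrow> c = col x"
  shows "col(x := c) = col"
  using assms nonzero[of x] by (auto simp: settled_def)

text \<open>Otherwise the agent never visits the private neighbours of \<open>f\<close>.\<close>

lemma enters_own:
  assumes win: "wins move C G 0 V (x, col)" and f: "b < f" "f \<le> N"
    and x: "x \<notin> own f" and V: "V \<inter> own f = {}" and ne: "own f \<noteq> {}"
    and col: "settled col" and own: "\<And>y. y \<in> own f \<Longrightarrow> col y = 0"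
  shows "\<exists>c. move (\<gamma> f) (clique_env (\<gamma> f) e (card (own f)) 0) = Go c 0"
proof (rule ccontr)
  assume not: "\<not> ?thesis"
  obtain z where z: "z \<in> own f" using ne by blast
  define Inv where "Inv V x col \<longleftrightarrow> x \<notin> own f \<and> V \<inter> own f = {} \<and> settled col \<and>
    (\<forall>y\<in>own f. col y = 0)" for V x and col :: "nat \<Rightarrow> nat"
  show False
  proof (rule wins_trap[where Inv = Inv, OF valid pair_graph_G win])
    show "Inv V x col" using assms by (simp add: Inv_def)
  next
    fix V x and col :: "nat \<Rightarrow> nat"
    assume "Inv V x col" "pverts G \<subseteq> V"
    then show False using z own_in_G[OF z] by (auto simp: Inv_def)
  next
    fix V x c d and col :: "nat \<Rightarrow> nat"
    assume inv: "Inv V x col" and dec: "decide move G (x, col) = Go c d"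
      and c: "col x \<noteq> 0 \<Longrightarrow> c = col x" and ex: "\<exists>y. (x, y) \<in> parcs G \<and> col y = d"
    obtain y where y: "(x, y) \<in> parcs G" "col y = d" using ex by blast
    have "y \<notin> own f"
    proof
      assume yo: "y \<in> own f"
      then have "x = f" using nbrs_own[OF f yo] G_sym[OF y(1)] by blast
      have "marked col f = 0" using inv finite_own by (auto simp: Inv_def marked_def)
      then have "move (\<gamma> f) (clique_env (\<gamma> f) e (card (own f)) 0) = Go c d"
        using decide_clique[OF f, of col e] inv dec \<open>x = f\<close> by (simp add: Inv_def settled_def)
      moreover have "d = 0" using y(2) yo inv by (simp add: Inv_def)
      ultimately show False using not by blast
    qed
    moreover have "\<forall>z\<in>own f. (col(x := c)) z = 0" using inv by (auto simp: Inv_def)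
    ultimately have "Inv (insert y V) y (col(x := c))"
      using inv settled_step[of col x c] c by (auto simp: Inv_def)
    then show "\<exists>y. (x, y) \<in> parcs G \<and> col y = d \<and> Inv (insert y V) y (col(x := c))"
      using y by blast
  qed
qed

text \<open>
  Two clique vertices \<open>f\<close> and \<open>g\<close> of the same colour: the adversary always chooses \<open>g\<close>, so that \<open>f\<close>
  stays unvisited, until \<open>g\<close> itself asks for their common colour after \<open>s\<close> of its leaves are
  coloured. Then \<open>f\<close> behaves as \<open>g\<close> did, and from that moment on the agent oscillates between them.
\<close>

lemma oscillation:
  assumes win: "wins move C G 0 V (x, col)"
    and f: "b < f" "f \<le> N" and g: "b < g" "g \<le> N" and fg: "f \<noteq> g" "\<gamma> f = \<gamma> g"
    and q: "card (own f) = card (own g)" and ne: "own f \<noteq> {}"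
    and x: "x \<notin> insert f (own f)" and V: "V \<inter> own f = {}"
    and col: "settled col" and own: "\<And>y. y \<in> own f \<union> own g \<Longrightarrow> col y = 0"
  shows False
proof -
  define a where "a = \<gamma> g"
  define e where "e = leaf_colour a"
  define env where "env t = clique_env a e (card (own g)) t" for t
  define cols where "cols col \<longleftrightarrow> settled col \<and> (\<forall>y\<in>own f \<union> own g. col y \<in> {0, e})"
    for col :: "nat \<Rightarrow> nat"
  \<comment> \<open>Marked neighbours of \<open>g\<close> appear one at a time, each after
    \<open>g\<close> has asked for an uncoloured vertex; these past decisions are what
    \<open>f\<close> will repeat.\<close>
  define eager where "eager s \<longleftrightarrow> (\<forall>t<s. \<exists>c. move a (env t) = Go c 0)" for s
  \<comment> \<open>The last conjunct concerns a visit to an uncoloured private neighbour of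
    \<open>g\<close>: colouring it extends \<open>eager\<close> by one.\<close>
  define Inv1 where "Inv1 V x col \<longleftrightarrow> x \<notin> insert f (own f) \<and> V \<inter> own f = {} \<and> cols col \<and>
    (\<forall>y\<in>own f. col y = 0) \<and> eager (marked col g) \<and>
    (x \<in> own g \<and> col x = 0 \<longrightarrow> (\<exists>c. move a (env (marked col g)) = Go c 0))"
    for V x and col :: "nat \<Rightarrow> nat"
  \<comment> \<open>With fewer marked neighbours than \<open>g\<close>, the vertex \<open>f\<close>
    repeats an earlier decision of \<open>g\<close> and sends the agent to one of its own uncoloured
    leaves; at equality it asks for \<open>a\<close> and the agent is sent to
    \<open>g\<close>.\<close>
  define Inv2 where "Inv2 x col \<longleftrightarrow> cols col \<and> eager (marked col g) \<and>
    (\<exists>c. move a (env (marked col g)) = Go c a) \<and> marked col f \<le> marked col g \<and>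
    (x = f \<or> x = g \<or> x \<in> own f \<and> col x = 0 \<and> marked col f < marked col g)"
    for x and col :: "nat \<Rightarrow> nat"
  have disj: "own f \<inter> own g = {}"
    using nbrs_own[OF f] nbrs_own[OF g] fg(1) by blast
  have g_notin: "g \<notin> own f" "f \<notin> own g" using own_gt[OF f, of g] own_gt[OF g, of f] f g by auto
  have f_notin: "f \<notin> own f" "g \<notin> own g" using own_gt[OF f, of f] own_gt[OF g, of g] f g by auto
  have a: "a \<noteq> 0" using nonzero g by (simp add: a_def)
  have decide_f: "decide move G (f, col) = move a (env (marked col f))" if "cols col" for col
    using decide_clique[OF f, of col e] that fg q by (simp add: cols_def settled_def env_def a_def)
  have decide_g: "decide move G (g, col) = move a (env (marked col g))" if "cols col" for col
    using decide_clique[OF g, of col e] that by (simp add: cols_def settled_def env_def a_def)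
  have col_fg: "col f = a" "col g = a" if "cols col" for col
    using that f g fg by (simp_all add: cols_def settled_def a_def)
  have e: "c = e" if "cols col" "y \<in> own f \<union> own g" "col y = 0" "decide move G (y, col) = Go c d"
    for col y c d
    using that decide_own[OF f, of y col] decide_own[OF g, of y col] col_fg[OF that(1)] fg
    by (auto simp: e_def a_def)
  have cols_step: "cols (col(x := c))"
    if "cols col" "decide move G (x, col) = Go c d" "col x \<noteq> 0 \<Longrightarrow> c = col x" for col x c d
  proof -
    have "c \<in> {0, e}" if x: "x \<in> own f \<union> own g"
    proof (cases "col x = 0")
      case True
      then show ?thesis using e[OF \<open>cols col\<close> x _ \<open>decide move G (x, col) = Go c d\<close>] by simp
    next
      case False
      then have "c = col x" by (rule \<open>col x \<noteq> 0 \<Longrightarrow> c = col x\<close>)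
      moreover have "col x \<in> {0, e}" using \<open>cols col\<close> x unfolding cols_def by blast
      ultimately show ?thesis by simp
    qed
    then show ?thesis using that settled_step[of col x c] by (auto simp: cols_def)
  qed
  show False
  proof (rule wins_trap[where Inv = "\<lambda>V x col. Inv1 V x col \<or> Inv2 x col", OF valid pair_graph_G win])
    have "marked col g = 0" using own finite_own by (auto simp: marked_def)
    \<comment> \<open>The agent may already stand at an uncoloured private neighbour of
      \<open>g\<close>, so the decision with nothing marked must be known at the outset.\<close>
    moreover have "\<exists>c. move a (env 0) = Go c 0"
      using enters_own[OF win f _ V ne col, of e] x own fg q by (simp add: a_def env_def)
    ultimately show "Inv1 V x col \<or> Inv2 x col"
      using x V col own by (auto simp: Inv1_def cols_def eager_def)
  next
    fix V x and col :: "nat \<Rightarrow> nat"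
    assume inv: "Inv1 V x col \<or> Inv2 x col" and "x = 0" "pverts G \<subseteq> V"
    then have "Inv1 V x col"
      using own_gt[OF f, of x] f(1) g(1) by (auto simp: Inv2_def)
    then show False using ne own_in_G \<open>pverts G \<subseteq> V\<close> by (auto simp: Inv1_def)
  next
    fix V x c d and col :: "nat \<Rightarrow> nat"
    assume inv: "Inv1 V x col \<or> Inv2 x col" and dec: "decide move G (x, col) = Go c d"
      and c: "col x \<noteq> 0 \<Longrightarrow> c = col x" and ex: "\<exists>y. (x, y) \<in> parcs G \<and> col y = d"
    have cols: "cols col" using inv by (auto simp: Inv1_def Inv2_def)
    have cols': "cols (col(x := c))" by (rule cols_step[OF cols dec c])
    obtain y where y: "(x, y) \<in> parcs G" "col y = d" using ex by blast
    have fg_arc: "(f, g) \<in> parcs G" "(g, f) \<in> parcs G" using clique_arc f g fg(1) by auto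
    let ?goal = "\<exists>y. (x, y) \<in> parcs G \<and> col y = d \<and>
        (Inv1 (insert y V) y (col(x := c)) \<or> Inv2 y (col(x := c)))"
    from inv show ?goal
    proof
      assume inv1: "Inv1 V x col"
      then have x: "x \<notin> insert f (own f)" and V: "V \<inter> own f = {}"
        and own_f: "\<forall>y\<in>own f. col y = 0" and eager: "eager (marked col g)"
        and pending: "x \<in> own g \<and> col x = 0 \<longrightarrow> (\<exists>c. move a (env (marked col g)) = Go c 0)"
        by (auto simp: Inv1_def)
      have y_own_f: "y \<notin> own f" if "(x, y) \<in> parcs G" for y
        using nbrs_own[OF f, of y] G_sym[OF that] x by blast
      have own_f': "\<forall>y\<in>own f. (col(x := c)) y = 0" using own_f x by auto
      consider "x = g" | "x \<in> own g" | "x \<noteq> g" "x \<notin> own g" by blast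
      then show ?goal
      proof cases
        case 1
        have same: "col(x := c) = col"
          using settled_core[of col x c] c cols g 1 by (simp add: cols_def)
        have go: "move a (env (marked col g)) = Go c d" using decide_g[OF cols] dec 1 by simp
        show ?thesis
        proof (cases "d = a")
          case True
          have "marked col f = 0" using own_f finite_own by (auto simp: marked_def)
          then have "Inv2 f (col(x := c))"
            using same cols eager go True by (auto simp: Inv2_def)
          then show ?thesis using fg_arc 1 True col_fg[OF cols] by blast
        next
          case False
          then have "y \<noteq> f" using y col_fg[OF cols] by auto
          then have "Inv1 (insert y V) y (col(x := c))"
            using y_own_f[OF y(1)] V cols own_f eager go y(2) unfolding same Inv1_def by auto
          then show ?thesis using y by blast
        qed
      next
        case 2
        have "y = g" using nbrs_own[OF g 2] y(1) by blast
        have "eager (marked (col(x := c)) g)"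
        proof (cases "col x = 0")
          case True
          then show ?thesis
            using marked_colour[of x g col c, OF 2 True] eager pending 2 by (auto simp: eager_def less_Suc_eq)
        next
          case False
          then have "col(x := c) = col" using c by auto
          then show ?thesis using eager by simp
        qed
        then have "Inv1 (insert y V) y (col(x := c))"
          using \<open>y = g\<close> g_notin f_notin fg V cols' own_f' unfolding Inv1_def by auto
        then show ?thesis using y by blast
      next
        case 3
        have eager': "eager (marked (col(x := c)) g)" using marked_other[OF 3(2)] eager by simp
        show ?thesis
        proof (cases "y = f")
          case True
          \<comment> \<open>Apart from its private neighbours, \<open>f\<close> is adjacent to
            clique vertices only, and these also see \<open>g\<close>, which has the same
            colour.\<close>
          have "x \<in> {b..N}" using y(1) True G_sym[OF y(1)] x by (auto simp: own_def)
          then have "(x, g) \<in> parcs G" using clique_arc[of x g] 3(1) g by auto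
          moreover have "col g = d" using y(2) True col_fg[OF cols] by simp
          moreover have "Inv1 (insert g V) g (col(x := c))"
            using g_notin f_notin fg V cols' own_f' eager' unfolding Inv1_def by auto
          ultimately show ?thesis by blast
        next
          case False
          have "y \<notin> own g" using nbrs_own[OF g, of y] G_sym[OF y(1)] 3(1) by blast
          then have "Inv1 (insert y V) y (col(x := c))"
            using False y_own_f[OF y(1)] V cols' own_f' eager' unfolding Inv1_def by auto
          then show ?thesis using y by blast
        qed
      qed
    next
      assume inv2: "Inv2 x col"
      then have eager: "eager (marked col g)" and swing: "\<exists>c. move a (env (marked col g)) = Go c a"
        and le: "marked col f \<le> marked col g" by (auto simp: Inv2_def)
      consider "x = g" | "x = f" | "x \<in> own f" "col x = 0" "marked col f < marked col g"
        using inv2 by (auto simp: Inv2_def)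
      then show ?goal
      proof cases
        case 1
        have same: "col(x := c) = col"
          using settled_core[of col x c] c cols g 1 by (simp add: cols_def)
        have "d = a" using swing decide_g[OF cols] dec 1 by auto
        moreover have "Inv2 f (col(x := c))" using same inv2 by (auto simp: Inv2_def)
        ultimately show ?thesis using fg_arc 1 col_fg[OF cols] by blast
      next
        case 2
        have same: "col(x := c) = col"
          using settled_core[of col x c] c cols f 2 by (simp add: cols_def)
        have go: "move a (env (marked col f)) = Go c d" using decide_f[OF cols] dec 2 by simp
        show ?thesis
        proof (cases "marked col f < marked col g")
          case True
          then have "d = 0" using go eager by (auto simp: eager_def)
          have "y \<in> own f"
          proof (rule ccontr)
            assume "y \<notin> own f"
            then have "y \<in> {b..N}" using y(1) 2 by (auto simp: own_def)
            then have "col y \<noteq> 0" using cols nonzero[of y] by (auto simp: cols_def settled_def)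
            then show False using y(2) \<open>d = 0\<close> by simp
          qed
          then have "Inv2 y (col(x := c))"
            using inv2 True y(2) \<open>d = 0\<close> unfolding same Inv2_def by blast
          then show ?thesis using y by blast
        next
          case False
          then have "marked col f = marked col g" using le by simp
          then have "d = a" using go swing by auto
          moreover have "Inv2 g (col(x := c))" using inv2 unfolding same Inv2_def by blast
          ultimately show ?thesis using fg_arc 2 col_fg[OF cols] by blast
        qed
      next
        case 3
        have "y = f" using nbrs_own[OF f 3(1)] y(1) by blast
        have "x \<notin> own g" using disj 3(1) by blast
        then have "marked (col(x := c)) g = marked col g" by (rule marked_other)
        moreover have "marked (col(x := c)) f \<le> marked col g"
          using marked_colour[of x f col c, OF 3(1,2)] 3(3) by simp
        ultimately have "Inv2 y (col(x := c))"
          using \<open>y = f\<close> cols' eager swing unfolding Inv2_def by simp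
        then show ?thesis using y by blast
      qed
    qed
  qed
qed

text \<open>On arrival at \<open>N\<close> the private neighbours of \<open>p\<close> and
  \<open>r\<close> are unvisited, and the next step completes the colouring of the clique, so
  \<open>oscillation\<close> applies after it. The agent must not stand at the vertex called
  \<open>f\<close> there, so the roles are exchanged if that step leads to \<open>p\<close>.\<close>

lemma block_colours_distinct:
  assumes fresh: "fresh_at N" and \<gamma>: "\<gamma> N = new_colour (move 0 (env \<gamma> (U N) (D N)))"
    and pr: "b < p" "p < r" "r \<le> N" and D: "D p = D r" "N - b < D p"
  shows "\<gamma> p \<noteq> \<gamma> r"
proof
  assume eq: "\<gamma> p = \<gamma> r"
  have NM: "N \<le> M" using M_eq by simp
  obtain V col where win: "wins move C G 0 V (N, col)"
    and V: "V \<subseteq> insert N (explored N)" and col: "fresh_col N col"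
    using fresh unfolding fresh_at_def by blast
  have p: "b < p" "p \<le> N" and r: "b < r" "r \<le> N" using pr by auto
  have card: "card (own p) = card (own r)" "card (own p) > 0"
    using card_own[OF p] card_own[OF r] D by auto
  have ne: "own p \<noteq> {}" "own r \<noteq> {}" using card by auto
  have out: "y \<notin> insert N (explored N)" if f: "b < f" "f \<le> N" and y: "y \<in> own f" for f y
  proof -
    have "N < y" by (rule own_gt[OF f y])
    moreover have "y \<notin> explored N"
    proof (cases "y = M")
      case True
      then show ?thesis using core_not_explored[of M N] NM by simp
    next
      case False
      then have "y \<in> leaves f" using own_cases[OF f y] by blast
      then show ?thesis using leaves_not_explored[OF NM, of y f] block[of N] f by (cases "f = N") auto
    qed
    ultimately show ?thesis by simp
  qed
  obtain c d where go: "decide move G (N, col) = Go c d"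
    and next_win: "\<And>s'. adversary_step move G (N, col) s' \<Longrightarrow> wins move C G 0 (insert (fst s') V) s'"
    using win
  proof cases
    case stop
    obtain y where y: "y \<in> own p" using ne by blast
    then show ?thesis using stop out[OF p y] own_in_G[OF y] V by auto
  next
    case (go c d)
    then show ?thesis using that by blast
  qed
  have c: "c = \<gamma> N" using go decide_fresh[OF NM col] \<gamma> by simp
  obtain y where y: "(N, y) \<in> parcs G" "col y = d"
    using Go_neighbour[OF valid pair_graph_G go] by auto
  define col' where "col' = col(N := c)"
  have "adversary_step move G (N, col) (y, col')"
    using go y by (simp add: adversary_step_def col'_def)
  from next_win[OF this] have win': "wins move C G 0 (insert y V) (y, col')" by simp
  have settled: "settled col'"
    using col c by (auto simp: settled_def col'_def fresh_col_def le_less)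
  have zero: "col' z = 0" if "z \<in> own p \<union> own r" for z
    using that out[OF p, of z] out[OF r, of z] col by (auto simp: col'_def fresh_col_def)
  have "N \<noteq> p" using pr by simp
  then have y_p: "y \<notin> own p" using nbrs_own[OF p, of y] G_sym[OF y(1)] by blast
  have V_pr: "V \<inter> own p = {}" "V \<inter> own r = {}" using V out[OF p] out[OF r] by blast+
  show False
  proof (cases "y = p")
    case True
    have "y \<notin> insert r (own r)" using True pr own_gt[OF r, of p] by auto
    then show False
      using oscillation[OF win' r p, of] pr eq card ne V_pr settled zero by auto
  next
    case False
    then show False
      using oscillation[OF win' p r] pr eq card ne V_pr settled zero y_p by auto
  qed
qed

end

section \<open>Chains of cliques\<close>

text \<open>Only the values of \<open>\<gamma>\<close> on \<open>T\<close> matter;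
  \<open>function\<close> needs this rule for the recursion of \<open>clique_colour\<close> through
  \<open>env\<close>.\<close>

lemma env_cong [fundef_cong]:
  "T = T' \<Longrightarrow> d = d' \<Longrightarrow> (\<And>l. l \<in> T' \<Longrightarrow> \<gamma> l = \<gamma>' l) \<Longrightarrow> env \<gamma> T d = env \<gamma>' T' d'"
  unfolding env_def by (intro ext arg_cong2[where f = "(+)"] arg_cong[where f = card]) auto

lemma env_shift: "env \<gamma> {b..<b + n} d = env (\<lambda>l. \<gamma> (b + l)) {..<n} d"
proof
  fix c
  have "{l \<in> {b..<b + n}. \<gamma> l = c} = (\<lambda>l. b + l) ` {l \<in> {..<n}. \<gamma> (b + l) = c}"
  proof (intro set_eqI iffI)
    fix l assume "l \<in> {l \<in> {b..<b + n}. \<gamma> l = c}"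
    then show "l \<in> (\<lambda>l. b + l) ` {l \<in> {..<n}. \<gamma> (b + l) = c}"
      by (intro image_eqI[of _ _ "l - b"]) auto
  qed auto
  then have "card {l \<in> {b..<b + n}. \<gamma> l = c} = card {l \<in> {..<n}. \<gamma> (b + l) = c}"
    by (simp add: card_image)
  then show "env \<gamma> {b..<b + n} d c = env (\<lambda>l. \<gamma> (b + l)) {..<n} d c"
    by (simp add: env_def)
qed

definition pair_env :: "nat \<Rightarrow> nat \<Rightarrow> nat \<Rightarrow> nat" where
  "pair_env a c = (\<lambda>z. (if z = a then 1 else 0) + (if z = c then 1 else 0))"

lemma pair_env_commute: "pair_env a c = pair_env c a"
  by (simp add: pair_env_def add.commute)

lemma env_pair:
  assumes "i \<noteq> j"
  shows "env \<gamma> {i, j} 2 = pair_env (\<gamma> i) (\<gamma> j)"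
proof
  fix z
  have "{l \<in> {i, j}. \<gamma> l = z} = (if z = \<gamma> i then {i} else {}) \<union> (if z = \<gamma> j then {j} else {})"
    by auto
  then show "env \<gamma> {i, j} 2 z = pair_env (\<gamma> i) (\<gamma> j) z"
    using assms by (simp add: env_def pair_env_def)
qed

text \<open>
  The core of the graph is a sequence of cliques: \<open>b j\<close> is the first vertex of the clique that \<open>j\<close>
  joins, and it is a cut vertex. Cliques have at most \<open>k - 1\<close> vertices, which leaves room for one
  extra vertex attached to the last of them.
\<close>

definition chain :: "nat \<Rightarrow> (nat \<Rightarrow> nat) \<Rightarrow> nat \<Rightarrow> bool" where
  "chain k b N \<longleftrightarrow> b 0 = 0 \<and> (\<forall>j. 0 < j \<and> j \<le> N \<longrightarrow> b j < j \<and> j \<le> b j + (k - 2)) \<and>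
     (\<forall>i j. i \<le> N \<and> j \<le> N \<and> b j < i \<longrightarrow> b j \<le> b i)"

text \<open>\<open>W\<close> is the neighbourhood of the extra vertex \<open>Suc N\<close>: the
  whole last clique for a twin, its first and last vertex for comparing two colours, or the last
  vertex alone for a pendant.\<close>

definition chain_back :: "(nat \<Rightarrow> nat) \<Rightarrow> nat \<Rightarrow> nat set \<Rightarrow> nat \<Rightarrow> nat set" where
  "chain_back b N W j = (if j \<le> N then {b j..<j} else W)"

definition chain_degree :: "nat \<Rightarrow> nat \<Rightarrow> nat \<Rightarrow> nat \<Rightarrow> nat" where
  "chain_degree k N d j = (if j \<le> N then 2 * k - 2 else d)"

lemma chain_prefix: "chain k b N \<Longrightarrow> i \<le> N \<Longrightarrow> chain k b i"
  by (simp add: chain_def)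

lemma chain_less: "chain k b N \<Longrightarrow> 0 < j \<Longrightarrow> j \<le> N \<Longrightarrow> b j < j"
  by (simp add: chain_def)

lemma chain_width: "chain k b N \<Longrightarrow> j \<le> N \<Longrightarrow> j \<le> b j + (k - 2)"
  by (cases "j = 0") (auto simp: chain_def)

lemma chain_nested: "chain k b N \<Longrightarrow> i \<le> N \<Longrightarrow> j \<le> N \<Longrightarrow> b j < i \<Longrightarrow> b j \<le> b i"
  by (simp add: chain_def)

lemma chain_le: "chain k b N \<Longrightarrow> j \<le> N \<Longrightarrow> b j \<le> j"
  by (cases "j = 0") (auto simp: chain_def less_imp_le)

lemma chain_mono:
  assumes ch: "chain k b N" and "j \<le> i" "i \<le> N"
  shows "b j \<le> b i"
proof (cases "j = 0")
  case True
  then show ?thesis using ch by (simp add: chain_def)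
next
  case False
  then have "b j < j" using chain_less[OF ch, of j] assms by simp
  then show ?thesis using chain_nested[OF ch, of i j] assms by simp
qed

lemma card_core_chain:
  assumes ch: "chain k b N" and j: "j \<le> N" and k: "2 \<le> k"
  shows "card (core_nbrs (Suc N) (chain_back b N W) j) < 2 * k - 2"
proof -
  \<comment> \<open>A later neighbour \<open>l\<close> in the chain has \<open>b l\<close> at most
    \<open>j\<close>, hence lies within \<open>k - 2\<close> of \<open>j\<close>.\<close>
  have "core_nbrs (Suc N) (chain_back b N W) j \<subseteq> {b j..<j} \<union> {j<..j + (k - 2)} \<union> {Suc N}"
  proof
    fix l assume l: "l \<in> core_nbrs (Suc N) (chain_back b N W) j"
    show "l \<in> {b j..<j} \<union> {j<..j + (k - 2)} \<union> {Suc N}"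
    proof (cases "l \<le> N")
      case True
      then show ?thesis
        using l j chain_width[OF ch True] by (auto simp: core_nbrs_def chain_back_def)
    next
      case False
      then show ?thesis using l by (auto simp: core_nbrs_def)
    qed
  qed
  then have "card (core_nbrs (Suc N) (chain_back b N W) j)
      \<le> card ({b j..<j} \<union> {j<..j + (k - 2)} \<union> {Suc N})"
    by (intro card_mono) auto
  also have "\<dots> \<le> card {b j..<j} + card {j<..j + (k - 2)} + card {Suc N}"
    by (meson add_le_mono1 card_Un_le le_trans)
  also have "\<dots> < 2 * k - 2" using chain_width[OF ch j] k by simp
  finally show ?thesis .
qed

lemma leafy_chain:
  assumes ch: "chain k b N" and k: "2 \<le> k" and W: "W \<subseteq> {b N..N}" "W \<noteq> {}" "card W \<le> d"
  shows "leafy (Suc N) (chain_back b N W) (chain_degree k N d)"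
proof
  fix i j assume "j \<le> Suc N" "i \<in> chain_back b N W j"
  then show "i < j" using W(1) by (auto simp: chain_back_def split: if_splits)
next
  fix j assume "0 < j" "j \<le> Suc N"
  then show "chain_back b N W j \<noteq> {}" using W(2) chain_less[OF ch, of j] by (auto simp: chain_back_def)
next
  fix i j l assume l: "i < j" "j < l" "l \<le> Suc N" "i \<in> chain_back b N W l"
  have "b j \<le> i"
  proof (cases "l \<le> N")
    case True
    then show ?thesis using l chain_mono[OF ch, of j l] by (auto simp: chain_back_def)
  next
    case False
    then have "b N \<le> i" using l W(1) by (auto simp: chain_back_def)
    then show ?thesis using l chain_mono[OF ch, of j N] by simp
  qed
  then show "i \<in> chain_back b N W j" using l by (simp add: chain_back_def)
next
  fix j assume "j \<le> Suc N"
  show "card (core_nbrs (Suc N) (chain_back b N W) j) \<le> chain_degree k N d j"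
  proof (cases "j \<le> N")
    case True
    then show ?thesis using card_core_chain[OF ch True k, of W] by (simp add: chain_degree_def)
  next
    case False
    then have "j = Suc N" using \<open>j \<le> Suc N\<close> by simp
    have "l \<in> core_nbrs (Suc N) (chain_back b N W) j \<longleftrightarrow> l \<in> W" for l
      using W(1) \<open>j = Suc N\<close> by (cases "l \<le> N") (auto simp: core_nbrs_def chain_back_def)
    then have "core_nbrs (Suc N) (chain_back b N W) j = W" by blast
    then show ?thesis using False W(3) by (simp add: chain_degree_def)
  qed
qed

lemma chain_cut:
  assumes ch: "chain k b N" and W: "W \<subseteq> {b N..N}" and j: "j \<le> N"
    and "i < b j" "b j < l" "l \<le> Suc N"
  shows "i \<notin> chain_back b N W l"
proof (cases "l \<le> N")
  case True
  then show ?thesis using chain_nested[OF ch True j] assms by (auto simp: chain_back_def)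
next
  case False
  then show ?thesis using W chain_mono[OF ch j order_refl] assms by (auto simp: chain_back_def)
qed

lemma circumference_chain:
  assumes ch: "chain k b N" and k: "2 \<le> k" and W: "W \<subseteq> {b N..N}" "W \<noteq> {}" "card W \<le> d"
  shows "circumference (leafy_graph (Suc N) (chain_back b N W) (chain_degree k N d)) \<le> k"
proof -
  interpret leafy "Suc N" "chain_back b N W" "chain_degree k N d" by (rule leafy_chain[OF assms])
  show ?thesis
  proof (rule circumference_le)
    fix j assume j: "0 < j" "j \<le> Suc N"
    show "\<exists>c<j. chain_back b N W j \<subseteq> {c..<j} \<and> Suc j \<le> c + k \<and>
        (\<forall>i l. i < c \<longrightarrow> c < l \<longrightarrow> l \<le> Suc N \<longrightarrow> i \<notin> chain_back b N W l)"
    proof (cases "j \<le> N")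
      case True
      show ?thesis
      proof (intro exI[of _ "b j"] conjI allI impI)
        show "b j < j" using chain_less[OF ch] j True by blast
        show "Suc j \<le> b j + k" using chain_width[OF ch True] k by simp
        show "chain_back b N W j \<subseteq> {b j..<j}" using True by (simp add: chain_back_def)
      qed (rule chain_cut[OF ch W(1) True])
    next
      case False
      then have jN: "j = Suc N" using j by simp
      show ?thesis
      proof (intro exI[of _ "b N"] conjI allI impI)
        show "b N < j" using chain_le[OF ch, of N] jN by simp
        \<comment> \<open>The last clique has at most \<open>k - 1\<close> vertices, so the extra
          vertex still fits into the bound.\<close>
        show "Suc j \<le> b N + k" using chain_width[OF ch, of N] k jN by simp
        show "chain_back b N W j \<subseteq> {b N..<j}" using W(1) jN by (auto simp: chain_back_def)
      qed (rule chain_cut[OF ch W(1) order_refl])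
    qed
  qed
qed

section \<open>The tournament of colours\<close>

text \<open>The arcs and their reversals are disjoint sets of pairs off the diagonal
  (\<open>asym\<close> with \<open>c = a\<close> excludes loops), so \<open>2 * (card R * m)\<close>
  is at most \<open>card R * (card R - 1)\<close>.\<close>

lemma tournament_card:
  fixes F :: "'a \<Rightarrow> 'a set"
  assumes fin: "finite R" and ne: "R \<noteq> {}" and sub: "\<And>a. a \<in> R \<Longrightarrow> F a \<subseteq> R"
    and card: "\<And>a. a \<in> R \<Longrightarrow> card (F a) = m"
    and asym: "\<And>a c. a \<in> R \<Longrightarrow> c \<in> F a \<Longrightarrow> a \<notin> F c"
  shows "2 * m < card R"
proof -
  define E where "E = Sigma R F"
  have finF: "finite (F a)" if "a \<in> R" for a using sub[OF that] fin by (rule finite_subset)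
  then have finE: "finite E" unfolding E_def using fin by (intro finite_SigmaI) auto
  have cardE: "card E = card R * m" unfolding E_def using fin finF card by (simp add: card_SigmaI)
  have disj: "E \<inter> E\<inverse> = {}" using asym by (auto simp: E_def)
  have "E \<union> E\<inverse> \<subseteq> R \<times> R - (\<lambda>a. (a, a)) ` R"
    using sub asym by (fastforce simp: E_def)
  then have "card (E \<union> E\<inverse>) \<le> card (R \<times> R - (\<lambda>a. (a, a)) ` R)"
    using fin by (intro card_mono) auto
  also have "\<dots> = card R * card R - card R"
    using fin by (subst card_Diff_subset) (auto simp: card_image inj_on_def card_cartesian_product)
  finally have "2 * (card R * m) \<le> card R * card R - card R"
    using card_Un_disjoint[OF finE _ disj] finE cardE by (simp add: card_inverse)
  then have "card R * (2 * m) \<le> card R * (card R - 1)" by (simp add: diff_mult_distrib2 ac_simps)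
  moreover have "card R > 0" using fin ne by (simp add: card_gt_0_iff)
  ultimately show ?thesis by simp
qed

locale exploration =
  fixes move :: algorithm and C :: "nat set" and k :: nat
  assumes valid: "valid_algorithm move" and k: "2 \<le> k"
    and explore: "\<And>G :: nat pair_pre_digraph. connected_graph G \<Longrightarrow> circumference G \<le> k \<Longrightarrow>
      explores move G \<and> assigned_colours move G \<subseteq> C"
begin

function clique_colour :: "nat \<Rightarrow> nat \<Rightarrow> nat" where
  "clique_colour a n =
     (if n = 0 then a else new_colour (move 0 (env (\<lambda>l. clique_colour a l) {..<n} (2 * k - 2))))"
  by auto
termination by (relation "measure snd") auto

declare clique_colour.simps [simp del]

text \<open>For a chain, \<open>b j < j\<close> fails only at the start vertex 0, whose neighbours
  are all uncoloured.\<close>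

function chain_colour :: "(nat \<Rightarrow> nat) \<Rightarrow> nat \<Rightarrow> nat" where
  "chain_colour b j =
     (if b j < j then clique_colour (chain_colour b (b j)) (j - b j)
      else new_colour (move 0 (env (\<lambda>_. 0) {} (2 * k - 2))))"
  by auto
termination by (relation "measure snd") auto

declare chain_colour.simps [simp del]

lemma chain_colour_block:
  assumes ch: "chain k b N" and j: "j \<le> N" and l: "b j \<le> l" "l < j"
  shows "chain_colour b l = clique_colour (chain_colour b (b j)) (l - b j)"
proof (cases "l = b j")
  case True
  then show ?thesis by (simp add: clique_colour.simps)
next
  case False
  have "b l \<le> b j" using chain_mono[OF ch, of l j] j l by simp
  moreover have "b j \<le> b l" using chain_nested[OF ch, of l j] j l False by simp
  ultimately have "b l = b j" by simp
  then show ?thesis using l False chain_colour.simps[of b l] by simp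
qed

text \<open>Shifting the clique of \<open>j\<close> to start at 0 turns the environment met at
  \<open>j\<close> into the one in the recursion of \<open>clique_colour\<close>. This ties the
  recursively defined colours to decisions of the agent.\<close>

lemma chain_colour_eq:
  assumes ch: "chain k b N" and j: "j \<le> N"
  shows "chain_colour b j = new_colour (move 0 (env (chain_colour b) {b j..<j} (2 * k - 2)))"
proof (cases "j = 0")
  case True
  then have "chain_colour b j = new_colour (move 0 (env (\<lambda>_. 0) {} (2 * k - 2)))"
    by (simp add: chain_colour.simps)
  also have "env (\<lambda>_. 0) {} (2 * k - 2) = env (chain_colour b) {b j..<j} (2 * k - 2)"
    using True by (intro env_cong) auto
  finally show ?thesis .
next
  case False
  then have bj: "b j < j" using chain_less[OF ch] j by simp
  let ?a = "chain_colour b (b j)"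
  have blk: "chain_colour b (b j + l) = clique_colour ?a l" if "l \<in> {..<j - b j}" for l
  proof -
    have "b j \<le> b j + l" "b j + l < j" using that by auto
    from chain_colour_block[OF ch j this] show ?thesis by (simp only: add_diff_cancel_left')
  qed
  have "env (chain_colour b) {b j..<b j + (j - b j)} (2 * k - 2) =
      env (\<lambda>l. chain_colour b (b j + l)) {..<j - b j} (2 * k - 2)" by (rule env_shift)
  also have "\<dots> = env (\<lambda>l. clique_colour ?a l) {..<j - b j} (2 * k - 2)"
    by (intro env_cong refl blk)
  finally have "env (chain_colour b) {b j..<j} (2 * k - 2) =
      env (\<lambda>l. clique_colour ?a l) {..<j - b j} (2 * k - 2)" using bj by simp
  moreover have "chain_colour b j = clique_colour ?a (j - b j)"
    using bj by (simp add: chain_colour.simps[of b j])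
  ultimately show ?thesis using bj clique_colour.simps[of ?a "j - b j"] by simp
qed

lemma leafy_walk_chain:
  assumes "chain k b N" "W \<subseteq> {b N..N}" "W \<noteq> {}" "card W \<le> d"
  shows "leafy_walk (Suc N) (chain_back b N W) (chain_degree k N d) move C"
proof -
  interpret leafy "Suc N" "chain_back b N W" "chain_degree k N d"
    by (rule leafy_chain) (use assms k in auto)
  have "circumference G \<le> k" by (rule circumference_chain) (use assms k in auto)
  then have "explores move G" "assigned_colours move G \<subseteq> C"
    using explore[OF connected_G] by blast+
  then show ?thesis
    by unfold_locales
      (use valid explores_wins[OF valid pair_graph_G _ _ core_in_G[of 0]] in auto)
qed

lemma fresh_chain:
  assumes ch: "chain k b N" and W: "W \<subseteq> {b N..N}" "W \<noteq> {}" "card W \<le> d"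
    and n: "n \<le> Suc N" and nz: "\<And>i. i < n \<Longrightarrow> chain_colour b i \<noteq> 0"
  shows "leafy_walk.fresh_at (Suc N) (chain_back b N W) (chain_degree k N d) move C (chain_colour b) n"
proof -
  interpret leafy_walk "Suc N" "chain_back b N W" "chain_degree k N d" move C "chain_colour b"
    by (rule leafy_walk_chain[OF ch W])
  show ?thesis
    using n nz
  proof (induction n)
    case 0
    then show ?case using fresh_at_0 by simp
  next
    case (Suc n)
    have "chain_colour b n =
        new_colour (move 0 (env (chain_colour b) (chain_back b N W n) (chain_degree k N d n)))"
      using chain_colour_eq[OF ch, of n] Suc.prems by (simp add: chain_back_def chain_degree_def)
    then show ?case using Suc by (intro fresh_at_Suc) auto
  qed
qed

lemma leaves_chain:
  assumes ch: "chain k b N" and W: "W \<subseteq> {b N..N}" "W \<noteq> {}" "card W \<le> d" and j: "j \<le> N"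
  shows "leafy.leaves (Suc N) (chain_back b N W) (chain_degree k N d) j \<noteq> {}"
proof -
  interpret leafy "Suc N" "chain_back b N W" "chain_degree k N d"
    by (rule leafy_chain[OF ch k W])
  have "card (leaves j) > 0"
    using card_leaves[of j] card_core_chain[OF ch j k, of W] j by (simp add: chain_degree_def)
  then show ?thesis by auto
qed

text \<open>Strong induction, because a fresh arrival at \<open>N\<close> is guaranteed only if all
  earlier colours are nonzero. Taking the whole last clique as \<open>?W\<close> makes
  \<open>Suc N\<close> a twin of \<open>N\<close>.\<close>

lemma chain_colour_in:
  assumes ch: "chain k b N"
  shows "chain_colour b N \<noteq> 0 \<and> chain_colour b N \<in> C"
  using ch
proof (induction N rule: less_induct)
  case (less N)
  let ?W = "{b N..N}" and ?d = "2 * k - 2"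
  have nz: "chain_colour b i \<noteq> 0" if "i < N" for i
    using less.IH[OF that] chain_prefix[OF less.prems, of i] that by simp
  have W: "?W \<subseteq> {b N..N}" "?W \<noteq> {}" "card ?W \<le> ?d"
    using chain_le[OF less.prems order_refl] chain_width[OF less.prems order_refl] k by auto
  interpret leafy_walk "Suc N" "chain_back b N ?W" "chain_degree k N ?d" move C "chain_colour b"
    by (rule leafy_walk_chain[OF less.prems W])
  have fresh: "fresh_at N" by (rule fresh_chain[OF less.prems W]) (use nz in auto)
  have leaf: "leaves N \<noteq> {}" by (rule leaves_chain[OF less.prems W order_refl])
  have eq: "chain_colour b N =
      new_colour (move 0 (env (chain_colour b) (chain_back b N ?W N) (chain_degree k N ?d N)))"
    using chain_colour_eq[OF less.prems order_refl] by (simp add: chain_back_def chain_degree_def)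
  have twin: "chain_back b N ?W (Suc N) = insert N (chain_back b N ?W N)"
    using chain_le[OF less.prems order_refl] by (auto simp: chain_back_def)
  have nonzero: "chain_colour b N \<noteq> 0"
    unfolding eq by (rule fresh_coloured) (use twin leaf fresh nz in \<open>auto simp: chain_degree_def\<close>)
  obtain z where z: "z \<in> leaves N" using leaf by blast
  have "z \<notin> insert N (explored N)" "z \<in> pverts G"
    using leaves_not_explored[of N z N] leaves_gt[OF z] z by (auto simp: leaves_def)
  then have "chain_colour b N \<in> insert 0 C"
    unfolding eq using fresh_colour[OF fresh, of z] by simp
  then show ?case using nonzero by simp
qed

text \<open>The condition \<open>0 < N\<close> lets each colour be carried by a cut vertex other
  than the start vertex, as \<open>link_avoids_root\<close> demands.\<close>

definition colours :: "nat set" where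
  "colours = {chain_colour b N |b N. chain k b N \<and> 0 < N}"

definition successors :: "nat \<Rightarrow> nat set" where
  "successors a = clique_colour a ` {1..k - 2}"

text \<open>Makes \<open>N\<close> the first vertex of one more clique, whose size is set only by
  the length of the chain considered.\<close>

definition extend :: "(nat \<Rightarrow> nat) \<Rightarrow> nat \<Rightarrow> nat \<Rightarrow> nat" where
  "extend b N j = (if j \<le> N then b j else N)"

lemma chain_extend:
  assumes "chain k b N" "l \<le> k - 2"
  shows "chain k (extend b N) (N + l)"
proof -
  have "b j \<le> N" if "j \<le> N" for j using chain_le[OF assms(1) that] that by simp
  then show ?thesis using assms unfolding chain_def extend_def by auto
qed

lemma chain_colour_extend: "chain k b N \<Longrightarrow> j \<le> N \<Longrightarrow> chain_colour (extend b N) j = chain_colour b j"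
proof (induction j rule: less_induct)
  case (less j)
  have bj: "extend b N j = b j" using less.prems(2) by (simp add: extend_def)
  have "chain_colour (extend b N) (b j) = chain_colour b (b j)" if "b j < j"
    using less.IH[OF that less.prems(1)] less.prems(2) that by simp
  then show ?case unfolding chain_colour.simps[of _ j] bj by simp
qed

lemma chain_colour_extend_add:
  assumes "chain k b N"
  shows "chain_colour (extend b N) (N + l) = clique_colour (chain_colour b N) l"
proof (cases "l = 0")
  case True
  then show ?thesis using chain_colour_extend[OF assms, of N] by (simp add: clique_colour.simps)
next
  case False
  then show ?thesis
    using chain_colour_extend[OF assms, of N]
    by (subst chain_colour.simps) (simp add: extend_def)
qed

lemma successors_subset:
  assumes "a \<in> colours"
  shows "successors a \<subseteq> colours"
proof
  fix c assume "c \<in> successors a"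
  then obtain l where l: "l \<in> {1..k - 2}" "c = clique_colour a l" by (auto simp: successors_def)
  obtain b N where b: "chain k b N" "0 < N" "a = chain_colour b N" using assms by (auto simp: colours_def)
  then have "c = chain_colour (extend b N) (N + l)" using l chain_colour_extend_add by simp
  moreover have "chain k (extend b N) (N + l)" using chain_extend[OF b(1)] l by simp
  ultimately show "c \<in> colours" using b(2) unfolding colours_def by fastforce
qed

text \<open>A chain ending in colour \<open>a\<close> is extended until colour \<open>c\<close>
  appears, and the extra vertex is joined to both ends of the new clique. The conclusion also yields
  that \<open>a\<close> and \<open>c\<close> differ.\<close>

lemma move_pair:
  assumes a: "a \<in> colours" and c: "c \<in> successors a"
  shows "\<exists>c' d. move 0 (pair_env a c) = Go c' d \<and> d \<in> {a, c} \<and> d \<noteq> a"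
proof -
  obtain b N where b: "chain k b N" "0 < N" "a = chain_colour b N" using a by (auto simp: colours_def)
  obtain l where l: "l \<in> {1..k - 2}" "c = clique_colour a l" using c by (auto simp: successors_def)
  let ?b = "extend b N" and ?N = "N + l" and ?W = "{N, N + l}"
  have ch: "chain k ?b ?N" using chain_extend[OF b(1)] l by simp
  have bN: "?b ?N = N" using l by (simp add: extend_def)
  have W: "?W \<subseteq> {?b ?N..?N}" "?W \<noteq> {}" "card ?W \<le> 2" using l bN by auto
  have nz: "chain_colour ?b i \<noteq> 0" if "i \<le> ?N" for i
    using chain_colour_in[OF chain_prefix[OF ch that]] by simp
  interpret leafy_walk "Suc ?N" "chain_back ?b ?N ?W" "chain_degree k ?N 2" move C "chain_colour ?b"
    by (rule leafy_walk_chain[OF ch W])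
  have fresh: "fresh_at (Suc ?N)" by (rule fresh_chain[OF ch W]) (use nz in auto)
  have cut: "i \<notin> chain_back ?b ?N ?W j" if "i < N" "N < j" "j \<le> Suc ?N" for i j
    using chain_cut[OF ch W(1) order_refl, of i j] that bN by simp
  obtain c' d where "move 0 (env (chain_colour ?b) {N, ?N} 2) = Go c' d"
    "d \<in> {chain_colour ?b N, chain_colour ?b ?N}" "d \<noteq> chain_colour ?b N"
    by (rule link_avoids_root[of ?N N])
      (use b(2) l fresh nz cut leaves_chain[OF ch W order_refl]
        in \<open>auto simp: chain_back_def chain_degree_def\<close>)
  moreover have "chain_colour ?b N = a" "chain_colour ?b ?N = c"
    using chain_colour_extend[OF b(1), of N] chain_colour_extend_add[OF b(1)] b(3) l(2) by simp_all
  moreover have "env (chain_colour ?b) {N, ?N} 2 = pair_env (chain_colour ?b N) (chain_colour ?b ?N)"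
    using l by (intro env_pair) auto
  ultimately show ?thesis by auto
qed

lemma successors_asym:
  assumes "a \<in> colours" "c \<in> successors a"
  shows "a \<notin> successors c"
proof
  assume "a \<in> successors c"
  moreover have "c \<in> colours" using successors_subset assms by blast
  ultimately show False
    using move_pair[OF assms] move_pair[of c a] pair_env_commute[of a c] by auto
qed

text \<open>A clique of maximal size is appended, so that it contains both offsets, and the extra
  vertex becomes a pendant at its end.\<close>

lemma clique_colour_distinct:
  assumes a: "a \<in> colours" and pr: "1 \<le> p" "p < r" "r \<le> k - 2"
  shows "clique_colour a p \<noteq> clique_colour a r"
proof -
  obtain b N where b: "chain k b N" "0 < N" "a = chain_colour b N" using a by (auto simp: colours_def)
  let ?b = "extend b N" and ?N = "N + (k - 2)"
  let ?W = "{?N}"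
  have ch: "chain k ?b ?N" using chain_extend[OF b(1)] by simp
  have W: "?W \<subseteq> {?b ?N..?N}" "?W \<noteq> {}" "card ?W \<le> 1" using chain_le[OF ch order_refl] by auto
  have nz: "chain_colour ?b i \<noteq> 0" if "i \<le> ?N" for i
    using chain_colour_in[OF chain_prefix[OF ch that]] by simp
  interpret leafy_walk "Suc ?N" "chain_back ?b ?N ?W" "chain_degree k ?N 1" move C "chain_colour ?b"
    by (rule leafy_walk_chain[OF ch W])
  interpret clique_end "Suc ?N" "chain_back ?b ?N ?W" "chain_degree k ?N 1" move C "chain_colour ?b" ?N N
    by unfold_locales (use nz in \<open>auto simp: chain_back_def chain_degree_def extend_def\<close>)
  have "chain_colour ?b (N + p) \<noteq> chain_colour ?b (N + r)"
  proof (rule block_colours_distinct)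
    show "fresh_at ?N" by (rule fresh_chain[OF ch W]) (use nz in auto)
    show "chain_colour ?b ?N = new_colour (move 0 (env (chain_colour ?b)
        (chain_back ?b ?N ?W ?N) (chain_degree k ?N 1 ?N)))"
      using chain_colour_eq[OF ch order_refl] by (simp add: chain_back_def chain_degree_def)
  qed (use pr k in \<open>auto simp: chain_degree_def\<close>)
  then show ?thesis using chain_colour_extend_add[OF b(1)] b(3) by simp
qed

lemma card_successors:
  assumes "a \<in> colours"
  shows "card (successors a) = k - 2"
proof -
  have "inj_on (clique_colour a) {1..k - 2}"
    using clique_colour_distinct[OF assms] by (intro linorder_inj_onI) auto
  then show ?thesis by (simp add: successors_def card_image)
qed

lemma card_colours:
  assumes "finite C"
  shows "2 * k - 3 \<le> card C"
proof (cases "k = 2")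
  case True
  \<comment> \<open>For \<open>k = 2\<close> the set \<open>colours\<close> is empty, and the single
    colour required is that of the start vertex.\<close>
  have "chain k (\<lambda>_. 0) 0" by (auto simp: chain_def)
  then have "C \<noteq> {}" using chain_colour_in by blast
  then show ?thesis using assms True by (simp add: Suc_le_eq card_gt_0_iff)
next
  case False
  have sub: "colours \<subseteq> C" using chain_colour_in by (auto simp: colours_def)
  have "chain k (\<lambda>_. 0) 1" using k False by (auto simp: chain_def)
  then have "colours \<noteq> {}" unfolding colours_def by fastforce
  then have "2 * (k - 2) < card colours"
    using finite_subset[OF sub assms] successors_subset card_successors successors_asym
    by (intro tournament_card[of colours successors]) auto
  also have "\<dots> \<le> card C" using assms sub by (rule card_mono)
  finally show ?thesis using k by simp
qed

end

theorem theorem9: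
  fixes k :: nat
  shows "\<not> (\<exists>(move :: algorithm) (C :: nat set).
            valid_algorithm move \<and>
            finite C \<and> int (card C) \<le> 2 * int k - 4 \<and>
            (\<forall>G :: nat pair_pre_digraph.
               connected_graph G \<and> circumference G \<le> k \<longrightarrow>
                 explores move G \<and> assigned_colours move G \<subseteq> C))"
proof
  assume "\<exists>(move :: algorithm) (C :: nat set).
            valid_algorithm move \<and>
            finite C \<and> int (card C) \<le> 2 * int k - 4 \<and>
            (\<forall>G :: nat pair_pre_digraph.
               connected_graph G \<and> circumference G \<le> k \<longrightarrow>
                 explores move G \<and> assigned_colours move G \<subseteq> C)"
  then obtain move C where valid: "valid_algorithm move" and fin: "finite C"
    and card: "int (card C) \<le> 2 * int k - 4"
    and explore: "\<And>G :: nat pair_pre_digraph. connected_graph G \<Longrightarrow> circumference G \<le> k \<Longrightarrow>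
      explores move G \<and> assigned_colours move G \<subseteq> C"
    by blast
  \<comment> \<open>The bound is an inequality of integers, so a nonnegative cardinality excludes
    smaller \<open>k\<close>.\<close>
  have k: "2 \<le> k" using card by simp
  interpret exploration move C k by unfold_locales (use valid k explore in blast)+
  show False using card_colours[OF fin] card k by simp
qed

end
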